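(* Let $\alpha\in(1,2)$, $H\in\left(\frac{2-\alpha}{2},\frac12\right)$, and let $u$ be the solution of the stochastic fractional heat equation described in the context. (a) There exist positive constants $c_{1,1},c_{1,2}$ such that for all $T,L>0$, $$c_{1,1}\,T^{\frac{2H+\alpha-2}{2\alpha}}\Psi(T,L)\le \mathbb{E}\Big[\sup_{0\le t\le T,\,-L\le x\le L}u(t,x)\Big]\le c_{1,2}\,T^{\frac{2H+\alpha-2}{2\alpha}}\Psi(T,L).$$ (b) There exist positive constants $c_{1,3},c_{1,4}$ such that for all $t>0$ and all $L\ge t^{1/\alpha}$, $$c_{1,3}\,t^{\frac{2H+\alpha-2}{2\alpha}}\Psi(t,L)\le \mathbb{E}\Big[\sup_{-L\le x\le L}u(t,x)\Big]\le c_{1,4}\,t^{\frac{2H+\alpha-2}{2\alpha}}\Psi(t,L).$$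
   Context: Fix $\alpha\in(1,2)$ and $H\in\left(\frac{2-\alpha}{2},\frac12\right)$. Fourier transform: $\mathcal F f(\xi)=\int_{\mathbb R}e^{-i\xi x}f(x)\,dx$. $G_\alpha(t,\cdot)$ ($t>0$) is the fundamental solution of $\partial_t=-(-\Delta)^{\alpha/2}$ on $\mathbb R$, i.e. $\mathcal F G_\alpha(t,\cdot)(\xi)=e^{-t|\xi|^\alpha}$. The noise is a centered Gaussian family $\{W(\phi):\phi\in C_c^\infty(\mathbb R_+\times\mathbb R)\}$ with $\mathbb E[W(\phi)W(\psi)]=\langle\phi,\psi\rangle_{\mathcal H}:=c_{1,H}\int_{\mathbb R_+}\int_{\mathbb R}\mathcal F\phi(s,\xi)\overline{\mathcal F\psi(s,\xi)}|\xi|^{1-2H}\,d\xi\,ds$, where $\mathcal F$ acts in the space variable and $c_{1,H}=\frac1{2\pi}\Gamma(2H+1)\sin(\pi H)$; equivalently $W$ is white in time and has the covariance of fractional Brownian motion with Hurst index $H$ in space. $\mathcal H$ is the completion of $C_c^\infty(\mathbb R_+\times\mathbb R)$ under $\langle\cdot,\cdot\rangle_{\mathcal H}$, and $W$ extends isometrically to $\mathcal H$ (Wiener integral). The solution of $\partial_t u=-(-\Delta)^{\alpha/2}u+\dot W$, $u(0,\cdot)=0$, is the centered Gaussian field $u(t,x)=\int_0^t\int_{\mathbb R}G_\alpha(t-s,x-y)\,W(ds,dy)$ (Wiener integral of $(s,y)\mapsto G_\alpha(t-s,x-y)\mathbf 1_{[0,t]}(s)$). Suprema are taken over a separable version of $u$.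 Define $\Psi(t,L):=1+\sqrt{\log_2\big(\frac{L}{t^{1/\alpha}}\vee 1\big)}$ for $t,L>0$. *)

theory Defs
  imports "HOL-Probability.Probability" "HOL-Analysis.Analysis"
begin

definition c1H :: "real \<Rightarrow> real" where
  "c1H H = Gamma (2 * H + 1) * sin (pi * H) / (2 * pi)"

text \<open>Spatial Fourier transform (in y) of the integrand
  (s,y) |-> G_alpha(t-s, x-y) 1_[0,t](s) of u(t,x), using
  F G_alpha(t,.)(xi) = exp(-t |xi|^alpha):
  value exp(-i xi x) exp(-(t-s)|xi|^alpha) for 0 <= s <= t, and 0 otherwise.\<close>
definition FG_kernel :: "real \<Rightarrow> real \<times> real \<Rightarrow> real \<Rightarrow> real \<Rightarrow> complex" where
  "FG_kernel \<alpha> p s \<xi> =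
     (if 0 \<le> s \<and> s \<le> fst p
      then cis (- \<xi> * snd p) * complex_of_real (exp (- (fst p - s) * \<bar>\<xi>\<bar> powr \<alpha>))
      else 0)"

text \<open>The inner product of the noise Hilbert space H applied to two such kernels:
  c_{1,H} int_{R_+} int_R F phi(s,xi) conj(F psi(s,xi)) |xi|^{1-2H} dxi ds.
  This is E[u(p) u(q)] (Wiener isometry).\<close>
definition u_cov :: "real \<Rightarrow> real \<Rightarrow> real \<times> real \<Rightarrow> real \<times> real \<Rightarrow> real" where
  "u_cov \<alpha> H p q =
     Re (complex_of_real (c1H H) *
        (LINT s:{0..}|lborel. (LINT \<xi>|lborel.
            FG_kernel \<alpha> p s \<xi> * cnj (FG_kernel \<alpha> q s \<xi>) *
            complex_of_real (\<bar>\<xi>\<bar> powr (1 - 2 * H)))))"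

text \<open>u is a (real-valued) centered Gaussian field on the probability space M indexed by
  (t,x) in [0,oo) x R with covariance u_cov: every u(p) is a random variable and every
  finite linear combination has the centered Gaussian characteristic function.\<close>
definition stoch_frac_heat_solution ::
    "'a measure \<Rightarrow> (real \<times> real \<Rightarrow> 'a \<Rightarrow> real) \<Rightarrow> real \<Rightarrow> real \<Rightarrow> bool" where
  "stoch_frac_heat_solution M u \<alpha> H \<longleftrightarrow>
     prob_space M \<and>
     (\<forall>p. fst p \<ge> 0 \<longrightarrow> u p \<in> borel_measurable M) \<and>
     (\<forall>(n::nat) (P::nat \<Rightarrow> real \<times> real) (a::nat \<Rightarrow> real) (\<theta>::real).
        (\<forall>k<n. fst (P k) \<ge> 0) \<longrightarrow>
        (\<integral>\<omega>. cis (\<theta> * (\<Sum>k<n. a k * u (P k) \<omega>)) \<partial>M) =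
          complex_of_real (exp (- (\<theta>\<^sup>2 / 2) *
             (\<Sum>j<n. \<Sum>k<n. a j * a k * u_cov \<alpha> H (P j) (P k)))))"

text \<open>Expected supremum of a process over an index set S, as for a separable version:
  the supremum of E[max over F] over finite nonempty F contained in S.\<close>
definition exp_sup :: "'a measure \<Rightarrow> ('i \<Rightarrow> 'a \<Rightarrow> real) \<Rightarrow> 'i set \<Rightarrow> ereal" where
  "exp_sup M u S =
     (SUP F \<in> {F. finite F \<and> F \<noteq> {} \<and> F \<subseteq> S}.
        ereal (\<integral>\<omega>. Max ((\<lambda>p. u p \<omega>) ` F) \<partial>M))"

definition Psi :: "real \<Rightarrow> real \<Rightarrow> real \<Rightarrow> real" where
  "Psi \<alpha> t L = 1 + sqrt (log 2 (max (L / t powr (1 / \<alpha>)) 1))"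

end

theory Submission
  imports Defs "HOL-Real_Asymp.Real_Asymp"
begin

text \<open>Carrying out the time integral first shows that the covariance is the cosine transform
  of an explicit spectral density; scaling then reduces everything to time 1.
  Upper bound: the increments have variance at most a constant times
  |t - t'|^((\<beta> - 1) / \<alpha>) + |x - x'|^(\<beta> - 1) with \<beta> = 2 H + \<alpha> - 1, and chaining along dyadic grids
  applies.
  Lower bound: at time 1 the spatial covariance decays like 1 / |x|, so about sqrt L points of
  [-L, L] carry values that are almost uncorrelated. A second moment argument for the average
  of exp (\<kappa> X) then gives a maximum of order sqrt (ln L), using only the laws of sums of two
  of the variables; no comparison inequality is needed.\<close>

subsection \<open>Centered Gaussian random variables\<close>

text \<open>The noise contributes |\<xi>|^(1 - 2H) to the spectral density and the time integral
  divides by |\<xi>|^\<alpha>; this is where \<beta> comes from. Integrability at infinity is 1 <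
  \<beta>, that is H > (2 - \<alpha>)/2; at 0 the difference of heat exponentials gains a factor
  |\<xi>|^\<alpha>. The condition \<beta> < \<alpha>, that is H < 1/2, makes even the derivative of
  the density integrable at 0, and this yields the decay of the covariance. Multiplying time by T
  and space by T^(1/\<alpha>) multiplies the field in law by T^\<gamma>, where \<gamma> = (\<beta> -
  1)/(2\<alpha>) is the exponent of the theorem; hence L enters only through L/T^(1/\<alpha>). An
  expected supremum is here a supremum over finite subsets: upper bounds must be uniform in the
  finite set, while one well chosen finite set proves a lower bound. The second moment bound is
  negative when there are few points, so bounded L is treated by two points: (1,-L) and (1,L), or,
  if [-L,L] is short, (1,0) and (0,0), where the field vanishes at the latter.\<close>

definition centered_normal :: "'a measure \<Rightarrow> ('a \<Rightarrow> real) \<Rightarrow> real \<Rightarrow> bool" where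
  "centered_normal M X v \<longleftrightarrow> X \<in> borel_measurable M \<and> 0 \<le> v \<and>
     distr M borel X = distr std_normal_distribution borel (\<lambda>z. sqrt v * z)"

text \<open>Levy's uniqueness theorem identifies the law. Describing it as an image of the standard
  normal law under scaling, and not through a density, includes the degenerate case
  \<open>v = 0\<close>, which occurs at time 0.\<close>

lemma (in prob_space) centered_normalI_cis:
  assumes X [measurable]: "X \<in> borel_measurable M"
    and cf: "\<And>\<theta>. (\<integral>\<omega>. cis (\<theta> * X \<omega>) \<partial>M) = complex_of_real (exp (- (\<theta>\<^sup>2 / 2) * v))"
  shows "centered_normal M X v"
proof -
  interpret X: real_distribution "distr M borel X" by simp
  interpret N: real_distribution std_normal_distribution by (rule real_dist_normal_dist)
  have char_X: "char (distr M borel X) \<theta> = complex_of_real (exp (- (\<theta>\<^sup>2 / 2) * v))" for \<theta>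
    using cf[of \<theta>] by (simp add: char_def integral_distr cis_conv_exp)
  \<comment> \<open>A characteristic function has modulus at most 1; at \<theta> = 1 this already
    forces the sign of \<open>v\<close>.\<close>
  have "exp (- v / 2) \<le> 1"
    using X.cmod_char_le_1[of 1] unfolding char_X by simp
  then have v: "0 \<le> v" by simp
  have "char (distr std_normal_distribution borel (\<lambda>z. sqrt v * z)) \<theta> = char (distr M borel X) \<theta>" for \<theta>
  proof -
    have "char (distr std_normal_distribution borel (\<lambda>z. sqrt v * z)) \<theta>
        = char std_normal_distribution (\<theta> * sqrt v)"
      by (simp add: char_def integral_distr mult.assoc)
    also have "\<dots> = char (distr M borel X) \<theta>"
      using v by (simp add: char_X char_std_normal_distribution power_mult_distrib)
    finally show ?thesis .
  qed
  then have "distr M borel X = distr std_normal_distribution borel (\<lambda>z. sqrt v * z)"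
    by (intro Levy_uniqueness) auto
  with v show ?thesis by (simp add: centered_normal_def)
qed

lemma centered_normal_nonneg: "centered_normal M X v \<Longrightarrow> 0 \<le> v"
  by (simp add: centered_normal_def)

lemma centered_normal_has_integral:
  assumes X: "centered_normal M X v" and [measurable]: "f \<in> borel_measurable borel"
    and f: "has_bochner_integral lborel (\<lambda>z. std_normal_density z * f (sqrt v * z)) (I::real)"
  shows "has_bochner_integral M (\<lambda>\<omega>. f (X \<omega>)) I"
proof -
  have [measurable]: "X \<in> borel_measurable M" using X by (simp add: centered_normal_def)
  have "has_bochner_integral std_normal_distribution (\<lambda>z. f (sqrt v * z)) I"
    using f by (intro has_bochner_integral_density) (auto)
  then have "has_bochner_integral (distr std_normal_distribution borel (\<lambda>z. sqrt v * z)) f I"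
    by (auto simp: has_bochner_integral_iff integral_distr integrable_distr_eq)
  then have "has_bochner_integral (distr M borel X) f I"
    using X by (simp add: centered_normal_def)
  then show ?thesis
    by (auto simp: has_bochner_integral_iff integral_distr integrable_distr_eq)
qed

lemma has_bochner_integral_std_normal_exp:
  "has_bochner_integral lborel (\<lambda>z. std_normal_density z * exp (a * z)) (exp (a\<^sup>2 / 2))"
proof -
  have "(\<lambda>z. std_normal_density z * exp (a * z)) = (\<lambda>z. exp (a\<^sup>2 / 2) * normal_density a 1 z)"
  proof
    fix z :: real
    have "- z\<^sup>2 / 2 + a * z = a\<^sup>2 / 2 + (- (z - a)\<^sup>2 / 2)"
      by (simp add: power2_eq_square field_simps)
    then have "exp (- z\<^sup>2 / 2) * exp (a * z) = exp (a\<^sup>2 / 2) * exp (- (z - a)\<^sup>2 / 2)"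
      by (simp flip: exp_add)
    then show "std_normal_density z * exp (a * z) = exp (a\<^sup>2 / 2) * normal_density a 1 z"
      by (simp add: normal_density_def)
  qed
  then show ?thesis by (simp add: has_bochner_integral_iff)
qed

lemma centered_normal_exp:
  assumes "centered_normal M X v"
  shows "has_bochner_integral M (\<lambda>\<omega>. exp (c * X \<omega>)) (exp (c\<^sup>2 * v / 2))"
  using centered_normal_nonneg[OF assms]
    has_bochner_integral_std_normal_exp[of "c * sqrt v"]
  by (intro centered_normal_has_integral[OF assms]) (auto simp: mult.assoc power_mult_distrib)

lemma centered_normal_mean:
  assumes "centered_normal M X v"
  shows "has_bochner_integral M X 0"
  using has_bochner_integral_mult_right[OF std_normal_moment_odd[of 0], of "sqrt v"]
  by (intro centered_normal_has_integral[OF assms, of "\<lambda>x. x", simplified])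
     (simp add: mult_ac)

lemma centered_normal_integrable: "centered_normal M X v \<Longrightarrow> integrable M X"
  using centered_normal_mean by (auto simp: has_bochner_integral_iff)

lemma centered_normal_abs_mean:
  assumes "centered_normal M X v"
  shows "has_bochner_integral M (\<lambda>\<omega>. \<bar>X \<omega>\<bar>) (sqrt (2 / pi) * sqrt v)"
  using has_bochner_integral_mult_right[OF std_normal_moment_abs_odd[of 0], of "sqrt v"]
    centered_normal_nonneg[OF assms]
  by (intro centered_normal_has_integral[OF assms, of "\<lambda>x. \<bar>x\<bar>"])
     (simp_all add: abs_mult mult_ac)

subsection \<open>Maxima of finitely many Gaussian variables\<close>

text \<open>For \<kappa> > 0 the maximum is at most 1/\<kappa> times the logarithm of the sum of the
  exp(\<kappa> Y j), and the expected sum is controlled by the marginal laws. The number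
  \<open>m\<close> may exceed the cardinality so that grid counts can be inserted.\<close>

lemma (in prob_space) expectation_Max_le:
  assumes J: "finite J" "J \<noteq> {}" and card: "real (card J) \<le> m" and m: "2 \<le> m"
    and d: "0 < d" and Y: "\<And>j. j \<in> J \<Longrightarrow> centered_normal M (Y j) (v j)"
    and v: "\<And>j. j \<in> J \<Longrightarrow> v j \<le> d\<^sup>2"
  shows "(\<integral>\<omega>. Max ((\<lambda>j. Y j \<omega>) ` J) \<partial>M) \<le> d * sqrt (2 * ln m)"
proof -
  \<comment> \<open>This value minimizes \<open>ln m / \<kappa> + \<kappa> * d\<^sup>2 / 2\<close>,
    the bound reached below.\<close>
  define \<kappa> where "\<kappa> = sqrt (2 * ln m) / d"
  have lnm: "0 < ln m" using m by simp
  then have \<kappa>: "0 < \<kappa>" using d by (simp add: \<kappa>_def)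
  define c where "c = m * exp (\<kappa>\<^sup>2 * d\<^sup>2 / 2)"
  have c: "0 < c" using m by (simp add: c_def)
  have int_max: "integrable M (\<lambda>\<omega>. Max ((\<lambda>j. Y j \<omega>) ` J))"
    using J Y by (intro integrable_MAX centered_normal_integrable)
  have int_exp: "integrable M (\<lambda>\<omega>. exp (\<kappa> * Y j \<omega>))"
    and mean_exp: "(\<integral>\<omega>. exp (\<kappa> * Y j \<omega>) \<partial>M) \<le> exp (\<kappa>\<^sup>2 * d\<^sup>2 / 2)" if "j \<in> J" for j
    using centered_normal_exp[OF Y[OF that], of \<kappa>] v[OF that] 
    by (auto simp: has_bochner_integral_iff mult_left_mono)
  \<comment> \<open>The tangent line of the logarithm at the point c replaces Jensen's inequality.\<close>
  have pointwise: "Max ((\<lambda>j. Y j \<omega>) ` J) \<le> (ln c + (\<Sum>j\<in>J. exp (\<kappa> * Y j \<omega>)) / c - 1) / \<kappa>" for \<omega>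
  proof -
    obtain j where j: "j \<in> J" "Max ((\<lambda>j. Y j \<omega>) ` J) = Y j \<omega>"
      using Max_in[of "(\<lambda>j. Y j \<omega>) ` J"] J by fastforce
    have "\<kappa> * Y j \<omega> - ln c = ln (exp (\<kappa> * Y j \<omega>) / c)"
      using c by (simp add: ln_div)
    also have "\<dots> \<le> exp (\<kappa> * Y j \<omega>) / c - 1"
      using c by (intro ln_le_minus_one) simp
    also have "\<dots> \<le> (\<Sum>j\<in>J. exp (\<kappa> * Y j \<omega>)) / c - 1"
      using J j c by (intro diff_right_mono divide_right_mono member_le_sum) auto
    finally show ?thesis
      using \<kappa> j by (simp add: field_simps)
  qed
  have "(\<integral>\<omega>. Max ((\<lambda>j. Y j \<omega>) ` J) \<partial>M)
      \<le> (\<integral>\<omega>. (ln c + (\<Sum>j\<in>J. exp (\<kappa> * Y j \<omega>)) / c - 1) / \<kappa> \<partial>M)"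
    using int_exp by (intro integral_mono int_max pointwise) auto
  also have "\<dots> = (ln c + (\<Sum>j\<in>J. (\<integral>\<omega>. exp (\<kappa> * Y j \<omega>) \<partial>M)) / c - 1) / \<kappa>"
    using int_exp by (simp add: prob_space)
  \<comment> \<open>The tangent point \<open>c\<close> is the bound for the expected sum, so the
    correction \<open>c / c - 1\<close> vanishes and only \<open>ln c\<close> is left.\<close>
  also have "\<dots> \<le> (ln c + c / c - 1) / \<kappa>"
  proof -
    have "(\<Sum>j\<in>J. (\<integral>\<omega>. exp (\<kappa> * Y j \<omega>) \<partial>M)) \<le> real (card J) * exp (\<kappa>\<^sup>2 * d\<^sup>2 / 2)"
      using sum_mono[OF mean_exp] by simp
    also have "\<dots> \<le> c" using card by (simp add: c_def)
    finally show ?thesis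
      using \<kappa> c by (intro divide_right_mono diff_right_mono add_left_mono) auto
  qed
  also have "\<dots> = (ln m + \<kappa>\<^sup>2 * d\<^sup>2 / 2) / \<kappa>"
    using m c by (simp add: c_def ln_mult)
  also have "\<dots> = 2 * ln m / \<kappa>"
    using d lnm by (simp add: \<kappa>_def power_divide)
  also have "\<dots> = d * (2 * ln m / sqrt (2 * ln m))"
    by (simp add: \<kappa>_def)
  also have "2 * ln m / sqrt (2 * ln m) = sqrt (2 * ln m)"
    using lnm by (simp add: real_div_sqrt)
  finally show ?thesis .
qed

text \<open>Since max x y = (x + y + |x - y|)/2 and both means vanish, only the absolute difference
  contributes.\<close>

lemma (in prob_space) expectation_max_two:
  assumes X: "centered_normal M X a" and Y: "centered_normal M Y b"
    and D: "centered_normal M (\<lambda>\<omega>. X \<omega> - Y \<omega>) v"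
  shows "(\<integral>\<omega>. max (X \<omega>) (Y \<omega>) \<partial>M) = sqrt v / sqrt (2 * pi)"
proof -
  have "(\<integral>\<omega>. max (X \<omega>) (Y \<omega>) \<partial>M) = (\<integral>\<omega>. (X \<omega> + Y \<omega> + \<bar>X \<omega> - Y \<omega>\<bar>) / 2 \<partial>M)"
    by (intro Bochner_Integration.integral_cong refl) (auto simp: max_def)
  also have "\<dots> = sqrt (2 / pi) * sqrt v / 2"
    using centered_normal_mean[OF X] centered_normal_mean[OF Y] centered_normal_abs_mean[OF D]
    by (simp add: has_bochner_integral_iff)
  also have "\<dots> = sqrt v / sqrt (2 * pi)"
    by (simp add: real_sqrt_divide real_sqrt_mult field_simps)
  finally show ?thesis .
qed

text \<open>Second moment method for the average of the variables exp (\<kappa> X i): weakly correlated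
  Gaussian variables have a maximum of the same order as independent ones.\<close>
lemma (in prob_space) expectation_Max_ge:
  assumes J: "finite J" "J \<noteq> {}" and N: "exp 4 \<le> real (card J)" and v: "0 < v"
    and X: "\<And>j. j \<in> J \<Longrightarrow> centered_normal M (X j) v"
    and XX: "\<And>i j. i \<in> J \<Longrightarrow> j \<in> J \<Longrightarrow>
      centered_normal M (\<lambda>\<omega>. X i \<omega> + X j \<omega>) (2 * v + 2 * C i j)"
    and C: "\<And>i. i \<in> J \<Longrightarrow> C i i = v"
    and C': "\<And>i j. i \<in> J \<Longrightarrow> j \<in> J \<Longrightarrow> i \<noteq> j \<Longrightarrow> C i j * ln (card J) \<le> v"
  shows "sqrt v * (sqrt (ln (card J)) / 64 - 1) \<le> (\<integral>\<omega>. Max ((\<lambda>j. X j \<omega>) ` J) \<partial>M)"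
proof -
  define n where "n = real (card J)"
  have npos: "0 < n" using J by (simp add: n_def card_gt_0_iff)
  have n4: "4 \<le> ln n" using N npos unfolding n_def by (simp add: ln_ge_iff)
  \<comment> \<open>With this choice exp(\<kappa> X) has mean sqrt n and second moment n^2. In the
    second moment of the sum, the n diagonal terms of size n^2 and the about n^2 other terms of size
    about n are then both of order n^3, which is the squared normalization
    \<open>(n * E)\<^sup>2\<close>.\<close>
  define \<kappa> where "\<kappa> = sqrt (ln n / v)"
  have \<kappa>: "0 < \<kappa>" using n4 v by (simp add: \<kappa>_def)
  have \<kappa>2: "\<kappa>\<^sup>2 = ln n / v" using n4 v by (simp add: \<kappa>_def)
  have \<kappa>v: "\<kappa>\<^sup>2 * v = ln n" using v by (simp add: \<kappa>2)
  define E where "E = exp (ln n / 2)"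
  have E: "0 < E" "E * E = n" 
    using npos by (auto simp: E_def simp flip: exp_add)
  define S where "S \<omega> = (\<Sum>j\<in>J. exp (\<kappa> * X j \<omega>)) / n / E" for \<omega>
  have e1: "has_bochner_integral M (\<lambda>\<omega>. exp (\<kappa> * X j \<omega>)) E" if "j \<in> J" for j
    using centered_normal_exp[OF X[OF that], of \<kappa>] by (simp add: \<kappa>v E_def)
  have S1: "has_bochner_integral M S 1"
  proof -
    have "has_bochner_integral M S ((\<Sum>j\<in>J. E) / n / E)"
      unfolding S_def by (intro has_bochner_integral_divide has_bochner_integral_sum e1)
    then show ?thesis using npos E by (simp add: n_def)
  qed
  have e2: "has_bochner_integral M (\<lambda>\<omega>. exp (\<kappa> * X i \<omega>) * exp (\<kappa> * X j \<omega>)) (exp (\<kappa>\<^sup>2 * (v + C i j)))"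
    if "i \<in> J" "j \<in> J" for i j
  proof -
    have "\<kappa>\<^sup>2 * (2 * v + 2 * C i j) / 2 = \<kappa>\<^sup>2 * (v + C i j)" by (simp add: field_simps)
    then have "has_bochner_integral M (\<lambda>\<omega>. exp (\<kappa> * (X i \<omega> + X j \<omega>))) (exp (\<kappa>\<^sup>2 * (v + C i j)))"
      using centered_normal_exp[OF XX[OF that], of \<kappa>] by (simp only:)
    then show ?thesis by (simp add: distrib_left exp_add)
  qed
  \<comment> \<open>Off the diagonal the bound on \<open>C i j * ln (card J)\<close> says that
    \<kappa>^2 times the covariance is at most 1, so correlation costs no more than a factor e
    compared with independence.\<close>
  have e2_le: "exp (\<kappa>\<^sup>2 * (v + C i j)) \<le> n * (exp 1 + (if i = j then n else 0))" if "i \<in> J" "j \<in> J" for i j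
  proof (cases "i = j")
    case True
    have "exp (\<kappa>\<^sup>2 * (v + C i j)) = n * n"
      using True C[OF that(1)] npos unfolding distrib_left exp_add by (simp add: \<kappa>v)
    then show ?thesis using True npos by (simp add: distrib_left)
  next
    case False
    have "\<kappa>\<^sup>2 * C i j \<le> 1"
      using C'[OF that False] v by (simp add: \<kappa>2 n_def mult.commute)
    then have "exp (\<kappa>\<^sup>2 * (v + C i j)) \<le> n * exp 1"
      using npos by (simp add: distrib_left \<kappa>v exp_add)
    then show ?thesis using False by simp
  qed
  have S2_int: "integrable M (\<lambda>\<omega>. (S \<omega>)\<^sup>2)" and S2: "(\<integral>\<omega>. (S \<omega>)\<^sup>2 \<partial>M) \<le> 4"
  proof -
    have "has_bochner_integral M (\<lambda>\<omega>. (\<Sum>i\<in>J. \<Sum>j\<in>J. exp (\<kappa> * X i \<omega>) * exp (\<kappa> * X j \<omega>)) / (n * E)\<^sup>2)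
       ((\<Sum>i\<in>J. \<Sum>j\<in>J. exp (\<kappa>\<^sup>2 * (v + C i j))) / (n * E)\<^sup>2)"
      by (intro has_bochner_integral_divide has_bochner_integral_sum e2)
    moreover have "(S \<omega>)\<^sup>2 = (\<Sum>i\<in>J. \<Sum>j\<in>J. exp (\<kappa> * X i \<omega>) * exp (\<kappa> * X j \<omega>)) / (n * E)\<^sup>2" for \<omega>
      by (simp add: S_def power_divide power2_eq_square sum_product)
    ultimately have *: "has_bochner_integral M (\<lambda>\<omega>. (S \<omega>)\<^sup>2)
       ((\<Sum>i\<in>J. \<Sum>j\<in>J. exp (\<kappa>\<^sup>2 * (v + C i j))) / (n * E)\<^sup>2)"
      by simp
    have "(\<Sum>i\<in>J. \<Sum>j\<in>J. exp (\<kappa>\<^sup>2 * (v + C i j))) \<le> (\<Sum>i\<in>J. \<Sum>j\<in>J. n * (exp 1 + (if i = j then n else 0)))"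
      by (intro sum_mono e2_le)
    also have "\<dots> = n * (n * n * (exp 1 + 1))"
      using J by (simp add: sum.distrib sum_distrib_left[symmetric] sum.delta n_def algebra_simps)
    also have "\<dots> \<le> n * (n * n * 4)"
      using npos exp_le by (intro mult_left_mono) auto
    finally have bound: "(\<Sum>i\<in>J. \<Sum>j\<in>J. exp (\<kappa>\<^sup>2 * (v + C i j))) \<le> n * (n * n * 4)" .
    have nE: "(n * E)\<^sup>2 = n * (n * n)"
      using E(2) by (simp add: power2_eq_square algebra_simps)
    have "(\<Sum>i\<in>J. \<Sum>j\<in>J. exp (\<kappa>\<^sup>2 * (v + C i j))) / (n * E)\<^sup>2 \<le> 4"
      using bound npos unfolding nE by (simp add: divide_le_eq mult.commute mult.left_commute)
    with * show "integrable M (\<lambda>\<omega>. (S \<omega>)\<^sup>2)" "(\<integral>\<omega>. (S \<omega>)\<^sup>2 \<partial>M) \<le> 4"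
      by (auto simp: has_bochner_integral_iff)
  qed
  obtain j0 where j0: "j0 \<in> J" using J by auto
  define A where "A = sqrt v * sqrt (ln n) / 4"
  have A: "0 \<le> A" using v n4 by (simp add: A_def)
  \<comment> \<open>On this event exp(\<kappa> max) is at least E/2, so \<kappa> max is at least (ln
    n)/2 - ln 2. As ln n \<ge> 4, the term ln 2 takes away at most (ln n)/4, and (ln n)/4 is
    \<kappa> A.\<close>
  have S_half: "A \<le> Max ((\<lambda>j. X j \<omega>) ` J)" if "1 / 2 \<le> S \<omega>" for \<omega>
  proof -
    let ?m = "Max ((\<lambda>j. X j \<omega>) ` J)"
    have "(\<Sum>j\<in>J. exp (\<kappa> * X j \<omega>)) \<le> (\<Sum>j\<in>J. exp (\<kappa> * ?m))"
      using J \<kappa> by (intro sum_mono) (auto intro!: mult_left_mono Max_ge)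
    then have "S \<omega> \<le> exp (\<kappa> * ?m) / E"
      using E npos by (simp add: S_def divide_simps n_def mult.commute)
    with that have "1 / 2 \<le> exp (\<kappa> * ?m) / E" by linarith
    then have "1 / 2 \<le> exp (\<kappa> * ?m - ln n / 2)" by (simp only: E_def exp_diff)
    then have "ln (1 / 2) \<le> ln (exp (\<kappa> * ?m - ln n / 2))"
      by (subst ln_le_cancel_iff) auto
    then have "ln n / 2 - ln 2 \<le> \<kappa> * ?m" unfolding ln_exp by (simp add: ln_div)
    moreover have "ln 2 \<le> (1::real)" using ln_2_less_1 by simp
    ultimately have "ln n / 4 \<le> \<kappa> * ?m" using n4 by linarith
    moreover have "\<kappa> * A = ln n / 4"
      using v n4 by (simp add: \<kappa>_def A_def real_sqrt_divide)
    ultimately have "\<kappa> * A \<le> \<kappa> * ?m" by simp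
    then show ?thesis using \<kappa> by simp
  qed
  \<comment> \<open>A quadratic polynomial in S that minorizes the indicator of S \<ge> 1/2 replaces the
    Paley--Zygmund inequality.\<close>
  have pointwise: "A * ((S \<omega> - 1 / 2) / 4 - (S \<omega>)\<^sup>2 / 64) - \<bar>X j0 \<omega>\<bar> \<le> Max ((\<lambda>j. X j \<omega>) ` J)" for \<omega>
  proof (cases "1 / 2 \<le> S \<omega>")
    case True
    have "(S \<omega> - 1 / 2) / 4 - (S \<omega>)\<^sup>2 / 64 = 7 / 8 - ((S \<omega> - 8) / 8)\<^sup>2"
      by (simp add: power2_eq_square field_simps)
    then have "(S \<omega> - 1 / 2) / 4 - (S \<omega>)\<^sup>2 / 64 \<le> 1"
      using zero_le_power2[of "(S \<omega> - 8) / 8"] by linarith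
    then have "A * ((S \<omega> - 1 / 2) / 4 - (S \<omega>)\<^sup>2 / 64) \<le> A * 1"
      using A by (intro mult_left_mono)
    with S_half[OF True] show ?thesis by linarith
  next
    case False
    then have "(S \<omega> - 1 / 2) / 4 \<le> 0" by simp
    then have "(S \<omega> - 1 / 2) / 4 - (S \<omega>)\<^sup>2 / 64 \<le> 0"
      using zero_le_power2[of "S \<omega>"] by linarith
    then have "A * ((S \<omega> - 1 / 2) / 4 - (S \<omega>)\<^sup>2 / 64) \<le> 0"
      using A by (simp add: mult_nonneg_nonpos)
    moreover have "X j0 \<omega> \<le> Max ((\<lambda>j. X j \<omega>) ` J)" using J j0 by auto
    ultimately show ?thesis by linarith
  qed
  have absX: "has_bochner_integral M (\<lambda>\<omega>. \<bar>X j0 \<omega>\<bar>) (sqrt (2 / pi) * sqrt v)"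
    by (intro centered_normal_abs_mean X j0)
  \<comment> \<open>S has mean 1 and second moment at most 4, so the polynomial has mean at least
    1/8 - 4/64 = 1/16, and A/16 is the term with the factor 1/64. The event S < 1/2 is paid for by
    the mean of |X j0|, at most sqrt v.\<close>
  have "sqrt v * (sqrt (ln n) / 64 - 1) \<le> A * ((1 - 1 / 2) / 4 - 4 / 64) - sqrt (2 / pi) * sqrt v"
  proof -
    have "sqrt (2 / pi) \<le> 1" using pi_gt3 by simp
    then have "sqrt (2 / pi) * sqrt v \<le> 1 * sqrt v" using v by (intro mult_right_mono) auto
    then show ?thesis by (simp add: A_def algebra_simps)
  qed
  also have "\<dots> \<le> A * ((1 - 1 / 2) / 4 - (\<integral>\<omega>. (S \<omega>)\<^sup>2 \<partial>M) / 64) - sqrt (2 / pi) * sqrt v"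
    using A S2 by (intro diff_right_mono mult_left_mono) auto
  also have "\<dots> = (\<integral>\<omega>. A * ((S \<omega> - 1 / 2) / 4 - (S \<omega>)\<^sup>2 / 64) - \<bar>X j0 \<omega>\<bar> \<partial>M)"
    using S1 S2_int absX by (simp add: has_bochner_integral_iff prob_space)
  also have "\<dots> \<le> (\<integral>\<omega>. Max ((\<lambda>j. X j \<omega>) ` J) \<partial>M)"
  proof (intro integral_mono pointwise)
    show "integrable M (\<lambda>\<omega>. A * ((S \<omega> - 1 / 2) / 4 - (S \<omega>)\<^sup>2 / 64) - \<bar>X j0 \<omega>\<bar>)"
      using S1 S2_int absX by (simp add: has_bochner_integral_iff)
    show "integrable M (\<lambda>\<omega>. Max ((\<lambda>j. X j \<omega>) ` J))"
      using J X by (intro integrable_MAX centered_normal_integrable)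
  qed
  finally show ?thesis by (simp add: n_def)
qed

subsection \<open>Integrals against a power weight\<close>

lemma set_integrable_powr_Ioo_0_1:
  fixes p :: real
  assumes "- 1 < p"
  shows "set_integrable lborel {0<..<1} (\<lambda>x. x powr p)"
proof -
  have "set_integrable lborel (einterval (ereal 0) (ereal 1)) (\<lambda>x. x powr p)"
  proof (rule interval_integral_FTC_nonneg)
    show "DERIV (\<lambda>x. x powr (p + 1) / (p + 1)) x :> x powr p" if "ereal 0 < ereal x" for x
      using that assms by (auto intro!: derivative_eq_intros)
    show "isCont (\<lambda>x. x powr p) x" if "ereal 0 < ereal x" for x
      using that by (auto intro!: continuous_intros)
    have "((\<lambda>x. x powr (p + 1) / (p + 1)) \<longlongrightarrow> 0) (at_right 0)"
      using assms by real_asymp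
    then show "(((\<lambda>x. x powr (p + 1) / (p + 1)) \<circ> real_of_ereal) \<longlongrightarrow> 0) (at_right (ereal 0))"
      by (simp add: ereal_tendsto_simps)
    have "((\<lambda>x. x powr (p + 1) / (p + 1)) \<longlongrightarrow> 1 powr (p + 1) / (p + 1)) (at_left 1)"
      using assms by (intro tendsto_intros) auto
    then show "(((\<lambda>x. x powr (p + 1) / (p + 1)) \<circ> real_of_ereal) \<longlongrightarrow> 1 powr (p + 1) / (p + 1)) (at_left (ereal 1))"
      by (simp add: ereal_tendsto_simps)
  qed auto
  then show ?thesis by simp
qed

lemma set_integrable_powr_Ioi_1:
  fixes p :: real
  assumes "p < - 1"
  shows "set_integrable lborel {1<..} (\<lambda>x. x powr p)"
proof -
  have "set_integrable lborel (einterval (ereal 1) \<infinity>) (\<lambda>x. x powr p)"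
  proof (rule interval_integral_FTC_nonneg)
    show "DERIV (\<lambda>x. x powr (p + 1) / (p + 1)) x :> x powr p" if "ereal 1 < ereal x" for x
      using that assms by (auto intro!: derivative_eq_intros)
    show "isCont (\<lambda>x. x powr p) x" if "ereal 1 < ereal x" for x
      using that by (auto intro!: continuous_intros)
    have "((\<lambda>x. x powr (p + 1) / (p + 1)) \<longlongrightarrow> 1 powr (p + 1) / (p + 1)) (at_right 1)"
      using assms by (intro tendsto_intros) auto
    then show "(((\<lambda>x. x powr (p + 1) / (p + 1)) \<circ> real_of_ereal) \<longlongrightarrow> 1 powr (p + 1) / (p + 1)) (at_right (ereal 1))"
      by (simp add: ereal_tendsto_simps)
    have "((\<lambda>x. x powr (p + 1) / (p + 1)) \<longlongrightarrow> 0) at_top"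
      using assms by real_asymp
    then show "(((\<lambda>x. x powr (p + 1) / (p + 1)) \<circ> real_of_ereal) \<longlongrightarrow> 0) (at_left \<infinity>)"
      by (simp add: ereal_tendsto_simps)
  qed auto
  then show ?thesis by simp
qed

text \<open>Near 0 the product is of order |x|^(a - b) with a - b > -1; at infinity \<phi> is
  bounded and -b < -1. All improper spectral integrals below rest on this criterion.\<close>

lemma integrable_powr_weight:
  fixes a b C :: real and \<phi> :: "real \<Rightarrow> real"
  assumes ab: "1 < b" "b < 1 + a" and [measurable]: "\<phi> \<in> borel_measurable borel"
    and \<phi>: "\<And>x. \<bar>\<phi> x\<bar> \<le> C * min 1 (\<bar>x\<bar> powr a)"
  shows "integrable lborel (\<lambda>x. \<bar>x\<bar> powr (- b) * \<phi> x)"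
proof -
  \<comment> \<open>The two integrable pieces live on open intervals; the point 1 is added so that
    \<open>h\<close> dominates at every positive x.\<close>
  define h where "h x = indicator {0<..<1} x * x powr (a - b) + indicator {1<..} x * x powr (- b)
    + indicator {1} x" for x :: real
  have h: "integrable lborel h"
    using set_integrable_powr_Ioo_0_1[of "a - b"] set_integrable_powr_Ioi_1[of "- b"] ab
    unfolding h_def set_integrable_def by (intro Bochner_Integration.integrable_add) auto
  then have h': "integrable lborel (\<lambda>x. h (- x))"
    using lborel_integrable_real_affine[of h "- 1" 0] by simp
  have C: "0 \<le> C" using \<phi>[of 1] by simp
  have h_nonneg: "0 \<le> h x" for x by (simp add: h_def)
  have pos: "x powr (- b) * min 1 (x powr a) \<le> h x" if "0 < x" for x
  proof -
    consider "x < 1" | "x = 1" | "1 < x" by linarith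
    then show ?thesis
    proof cases
      case 1
      have "x powr (- b) * min 1 (x powr a) \<le> x powr (- b) * x powr a"
        by (intro mult_left_mono) auto
      then show ?thesis using 1 that by (simp add: h_def flip: powr_add)
    next
      case 3
      have "x powr (- b) * min 1 (x powr a) \<le> x powr (- b) * 1"
        by (intro mult_left_mono) auto
      then show ?thesis using 3 by (simp add: h_def)
    qed (simp add: h_def)
  qed
  have "\<bar>\<bar>x\<bar> powr (- b) * \<phi> x\<bar> \<le> C * (h x + h (- x))" for x
  proof -
    have "\<bar>x\<bar> powr (- b) * min 1 (\<bar>x\<bar> powr a) \<le> h x + h (- x)"
      using pos[of x] pos[of "- x"] h_nonneg[of x] h_nonneg[of "- x"]
      by (cases "x = 0"; cases "0 < x") auto
    then have "C * (\<bar>x\<bar> powr (- b) * min 1 (\<bar>x\<bar> powr a)) \<le> C * (h x + h (- x))"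
      using C by (intro mult_left_mono)
    moreover have "\<bar>x\<bar> powr (- b) * \<bar>\<phi> x\<bar> \<le> \<bar>x\<bar> powr (- b) * (C * min 1 (\<bar>x\<bar> powr a))"
      by (intro mult_left_mono \<phi>) auto
    ultimately show ?thesis by (simp add: abs_mult mult_ac)
  qed
  then have bound: "norm (\<bar>x\<bar> powr (- b) * \<phi> x) \<le> norm (C * (h x + h (- x)))" for x
    by (auto intro: order_trans[OF _ abs_ge_self])
  have "integrable lborel (\<lambda>x. C * (h x + h (- x)))"
    by (intro integrable_mult_right Bochner_Integration.integrable_add h h')
  then show ?thesis
    by (rule Bochner_Integration.integrable_bound[OF _ _ AE_I2[OF bound]]) measurable
qed

text \<open>The substitution x -> k x. It is the source of every power law below: the
  self-similarity of the covariance and the moduli of the space and time increments.\<close>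

lemma integral_powr_weight_scale:
  fixes b k :: real and \<phi> :: "real \<Rightarrow> real"
  assumes k: "0 < k"
  shows "(\<integral>x. \<bar>x\<bar> powr (- b) * \<phi> (k * x) \<partial>lborel)
    = k powr (b - 1) * (\<integral>x. \<bar>x\<bar> powr (- b) * \<phi> x \<partial>lborel)"
proof -
  have "(\<integral>x. \<bar>x\<bar> powr (- b) * \<phi> x \<partial>lborel) = k * (\<integral>x. \<bar>k * x\<bar> powr (- b) * \<phi> (k * x) \<partial>lborel)"
    using k by (subst lborel_integral_real_affine[of k _ 0]) auto
  also have "\<dots> = k * (\<integral>x. k powr (- b) * (\<bar>x\<bar> powr (- b) * \<phi> (k * x)) \<partial>lborel)"
    using k by (simp add: abs_mult powr_mult mult.assoc)
  also have "\<dots> = (k * k powr (- b)) * (\<integral>x. \<bar>x\<bar> powr (- b) * \<phi> (k * x) \<partial>lborel)"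
    by simp
  also have "k * k powr (- b) = k powr (1 - b)"
    using k by (simp add: powr_diff powr_minus field_simps)
  finally have "k powr (b - 1) * (\<integral>x. \<bar>x\<bar> powr (- b) * \<phi> x \<partial>lborel)
      = (k powr (b - 1) * k powr (1 - b)) * (\<integral>x. \<bar>x\<bar> powr (- b) * \<phi> (k * x) \<partial>lborel)"
    by simp
  also have "k powr (b - 1) * k powr (1 - b) = 1"
    using k by (simp flip: powr_add)
  finally show ?thesis by simp
qed

lemma one_minus_exp_le: "0 \<le> k \<Longrightarrow> 0 \<le> w \<Longrightarrow> 1 - exp (- k * w) \<le> max 1 k * min 1 (w::real)"
proof -
  assume k: "0 \<le> k" "0 \<le> w"
  have "1 - exp (- k * w) \<le> k * w" using exp_ge_add_one_self[of "- k * w"] by simp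
  moreover have "k * w \<le> max 1 k * w" using k by (intro mult_right_mono) auto
  moreover have "1 - exp (- k * w) \<le> max 1 k" by (simp add: le_max_iff_disj)
  ultimately show ?thesis by (auto simp: min_def)
qed

lemma one_minus_cos_le_power2: "1 - cos x \<le> (x::real)\<^sup>2 / 2"
proof -
  have "cos x = 1 - 2 * (sin (x / 2))\<^sup>2"
    using cos_double_sin[of "x / 2"] by simp
  moreover have "(sin (x / 2))\<^sup>2 \<le> (x / 2)\<^sup>2"
    using abs_sin_x_le_abs_x[of "x / 2"] by (metis abs_le_square_iff)
  ultimately show ?thesis by (simp add: power2_eq_square)
qed

lemma has_bochner_integral_mono:
  fixes f g :: "'a \<Rightarrow> real"
  assumes "has_bochner_integral M f a" "has_bochner_integral M g b" "\<And>z. f z \<le> g z"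
  shows "a \<le> b"
  using assms integral_mono[of M f g] by (auto simp: has_bochner_integral_iff)

section \<open>Laws of finite linear combinations of the field\<close>

lemma stoch_frac_heat_solution_prob_space: "stoch_frac_heat_solution M u \<alpha> H \<Longrightarrow> prob_space M"
  by (simp add: stoch_frac_heat_solution_def)

lemma stoch_frac_heat_solution_cis:
  fixes P :: "nat \<Rightarrow> real \<times> real"
  assumes "stoch_frac_heat_solution M u \<alpha> H" "\<And>k. k < n \<Longrightarrow> 0 \<le> fst (P k)"
  shows "(\<integral>\<omega>. cis (\<theta> * (\<Sum>k<n. a k * u (P k) \<omega>)) \<partial>M) =
      complex_of_real (exp (- (\<theta>\<^sup>2 / 2) * (\<Sum>j<n. \<Sum>k<n. a j * a k * u_cov \<alpha> H (P j) (P k))))"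
  using assms unfolding stoch_frac_heat_solution_def by blast

lemma centered_normal_lincomb:
  fixes P :: "nat \<Rightarrow> real \<times> real"
  assumes u: "stoch_frac_heat_solution M u \<alpha> H" and P: "\<And>k. k < n \<Longrightarrow> 0 \<le> fst (P k)"
  shows "centered_normal M (\<lambda>\<omega>. \<Sum>k<n. a k * u (P k) \<omega>)
    (\<Sum>j<n. \<Sum>k<n. a j * a k * u_cov \<alpha> H (P j) (P k))"
proof -
  interpret prob_space M using u by (rule stoch_frac_heat_solution_prob_space)
  have "u p \<in> borel_measurable M" if "0 \<le> fst p" for p
    using u that unfolding stoch_frac_heat_solution_def by blast
  then have "(\<lambda>\<omega>. \<Sum>k<n. a k * u (P k) \<omega>) \<in> borel_measurable M"
    using P by (intro borel_measurable_sum borel_measurable_times) auto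
  then show ?thesis
    by (rule centered_normalI_cis) (rule stoch_frac_heat_solution_cis[OF u P])
qed

subsection \<open>The covariance as a cosine transform\<close>

locale heat_parameters =
  fixes \<alpha> H :: real
  assumes \<alpha>1: "1 < \<alpha>" and \<alpha>2: "\<alpha> < 2" and H_lower: "(2 - \<alpha>) / 2 < H" and H_upper: "H < 1 / 2"
begin

definition \<beta> :: real where "\<beta> = 2 * H + \<alpha> - 1"

lemma \<beta>1: "1 < \<beta>" and \<beta>\<alpha>: "\<beta> < \<alpha>"
  using H_lower H_upper by (simp_all add: \<beta>_def)

lemma c1H_pos: "0 < c1H H"
proof -
  have H: "0 < H" using \<alpha>2 H_lower by simp
  have "0 < sin (pi * H)"
    using H H_upper by (intro sin_gt_zero) (auto simp: mult_less_cancel_left_pos)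
  moreover have "0 < Gamma (2 * H + 1)" using H by (intro Gamma_real_pos) simp
  ultimately show ?thesis by (simp add: c1H_def)
qed

lemma integrable_weight:
  assumes [measurable]: "\<phi> \<in> borel_measurable borel" and "\<And>x. \<bar>\<phi> x\<bar> \<le> C * min 1 (\<bar>x\<bar> powr \<alpha>)"
  shows "integrable lborel (\<lambda>x. \<bar>x\<bar> powr (- \<beta>) * \<phi> x)"
proof (rule integrable_powr_weight[OF _ _ assms])
  show "1 < \<beta>" by (rule \<beta>1)
  show "\<beta> < 1 + \<alpha>" using \<beta>\<alpha> by simp
qed

text \<open>Up to the factor \<open>c1H H\<close> this is the covariance, with \<tau> = |t - t'|,
  \<sigma> = t + t' and h = x - x'. The times enter in these two combinations because integrating
  exp(-(t + t' - 2s) w) over s from 0 to min t t' gives (exp(-\<tau> w) - exp(-\<sigma>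
  w))/(2w).\<close>

definition heat_int :: "real \<Rightarrow> real \<Rightarrow> real \<Rightarrow> real" where
  "heat_int \<tau> \<sigma> h = (\<integral>\<xi>. \<bar>\<xi>\<bar> powr (- \<beta>) *
     (cos (h * \<xi>) * (exp (- \<tau> * \<bar>\<xi>\<bar> powr \<alpha>) - exp (- \<sigma> * \<bar>\<xi>\<bar> powr \<alpha>)) / 2) \<partial>lborel)"

lemma exp_diff_bounds:
  assumes "0 \<le> \<tau>" "\<tau> \<le> \<sigma>" "0 \<le> w"
  shows "0 \<le> exp (- \<tau> * w) - exp (- \<sigma> * w)"
    and "exp (- \<tau> * w) - exp (- \<sigma> * w) \<le> max 1 \<sigma> * min 1 (w::real)"
proof -
  show "0 \<le> exp (- \<tau> * w) - exp (- \<sigma> * w)"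
    using assms by (simp add: mult_right_mono)
  have "exp (- \<tau> * w) \<le> 1" using assms by simp
  then have "exp (- \<tau> * w) - exp (- \<sigma> * w) \<le> 1 - exp (- \<sigma> * w)" by simp
  also have "\<dots> \<le> max 1 \<sigma> * min 1 w" using assms by (intro one_minus_exp_le) auto
  finally show "exp (- \<tau> * w) - exp (- \<sigma> * w) \<le> max 1 \<sigma> * min 1 w" .
qed

lemma integrable_heat_int:
  assumes "0 \<le> \<tau>" "\<tau> \<le> \<sigma>" and [measurable]: "\<phi> \<in> borel_measurable borel" and "\<And>\<xi>. \<bar>\<phi> \<xi>\<bar> \<le> 1"
  shows "integrable lborel (\<lambda>\<xi>. \<bar>\<xi>\<bar> powr (- \<beta>) *
     (\<phi> \<xi> * (exp (- \<tau> * \<bar>\<xi>\<bar> powr \<alpha>) - exp (- \<sigma> * \<bar>\<xi>\<bar> powr \<alpha>)) / 2))"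
proof (rule integrable_weight)
  fix \<xi>
  let ?d = "exp (- \<tau> * \<bar>\<xi>\<bar> powr \<alpha>) - exp (- \<sigma> * \<bar>\<xi>\<bar> powr \<alpha>)"
  have d: "0 \<le> ?d" "?d \<le> max 1 \<sigma> * min 1 (\<bar>\<xi>\<bar> powr \<alpha>)"
    using exp_diff_bounds[OF assms(1,2), of "\<bar>\<xi>\<bar> powr \<alpha>"] by auto
  have "\<bar>\<phi> \<xi> * ?d / 2\<bar> = \<bar>\<phi> \<xi>\<bar> * ?d / 2" using d by (simp add: abs_mult)
  also have "\<dots> \<le> 1 * ?d / 2" using d assms by (intro divide_right_mono mult_right_mono) auto
  also have "\<dots> \<le> ?d" using d by simp
  finally show "\<bar>\<phi> \<xi> * ?d / 2\<bar> \<le> max 1 \<sigma> * min 1 (\<bar>\<xi>\<bar> powr \<alpha>)" using d by linarith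
qed measurable

lemma has_bochner_integral_heat_int:
  assumes "0 \<le> \<tau>" "\<tau> \<le> \<sigma>"
  shows "has_bochner_integral lborel (\<lambda>\<xi>. \<bar>\<xi>\<bar> powr (- \<beta>) *
     (cos (h * \<xi>) * (exp (- \<tau> * \<bar>\<xi>\<bar> powr \<alpha>) - exp (- \<sigma> * \<bar>\<xi>\<bar> powr \<alpha>)) / 2)) (heat_int \<tau> \<sigma> h)"
  unfolding heat_int_def
proof (rule has_bochner_integral_integrable)
  show "integrable lborel (\<lambda>\<xi>. \<bar>\<xi>\<bar> powr (- \<beta>) *
     (cos (h * \<xi>) * (exp (- \<tau> * \<bar>\<xi>\<bar> powr \<alpha>) - exp (- \<sigma> * \<bar>\<xi>\<bar> powr \<alpha>)) / 2))"
    by (rule integrable_heat_int[OF assms]) simp_all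
qed

lemma has_bochner_integral_exp_Icc:
  fixes m w r :: real
  assumes m: "0 \<le> m" and w: "0 < w"
  shows "has_bochner_integral lborel (\<lambda>s. indicator {0..m} s *\<^sub>R exp (- (r - 2 * s) * w))
    ((exp (- (r - 2 * m) * w) - exp (- r * w)) / (2 * w))"
proof -
  let ?F = "\<lambda>s. exp (- (r - 2 * s) * w) / (2 * w)"
  have "integral\<^sup>L lborel (\<lambda>s. indicator {0..m} s *\<^sub>R exp (- (r - 2 * s) * w)) = ?F m - ?F 0"
    using m w
    by (intro integral_FTC_atLeastAtMost)
       (auto intro!: derivative_eq_intros continuous_intros simp flip: has_real_derivative_iff_has_vector_derivative)
  moreover have "set_integrable lborel {0..m} (\<lambda>s. exp (- (r - 2 * s) * w))"
    by (intro borel_integrable_atLeastAtMost' continuous_intros)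
  ultimately show ?thesis
    by (simp add: has_bochner_integral_iff set_integrable_def diff_divide_distrib)
qed

text \<open>Fubini. The two kernels multiply to a nonnegative heat factor times a phase of modulus
  1, so absolute integrability is the case of spatial lag 0. The real part in \<open>u_cov\<close>
  turns the phase into a cosine.\<close>

lemma u_cov_eq:
  assumes t: "0 \<le> t" "0 \<le> t'"
  shows "u_cov \<alpha> H (t, x) (t', x') = c1H H * heat_int \<bar>t - t'\<bar> (t + t') (x - x')"
proof -
  \<comment> \<open>The product of the kernels vanishes once s exceeds one of the two times.\<close>
  define m where "m = min t t'"
  have m: "0 \<le> m" "t + t' - 2 * m = \<bar>t - t'\<bar>" using t by (auto simp: m_def)
  define E where "E \<xi> s = indicator {0..m} s *\<^sub>R exp (- (t + t' - 2 * s) * \<bar>\<xi>\<bar> powr \<alpha>)" for \<xi> s :: real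
  define F where "F \<xi> s = cis (- \<xi> * (x - x')) * of_real (\<bar>\<xi>\<bar> powr (1 - 2 * H) * E \<xi> s)" for \<xi> s
  have F_kernel: "indicator {0..} s *\<^sub>R (FG_kernel \<alpha> (t, x) s \<xi> * cnj (FG_kernel \<alpha> (t', x') s \<xi>) *
            complex_of_real (\<bar>\<xi>\<bar> powr (1 - 2 * H))) = F \<xi> s" for \<xi> s
  proof (cases "0 \<le> s \<and> s \<le> m")
    case True
    then have s: "0 \<le> s" "s \<le> t" "s \<le> t'" by (auto simp: m_def)
    have "cis (- \<xi> * x) * cis (\<xi> * x') = cis (- \<xi> * (x - x'))"
      by (simp add: cis_mult algebra_simps)
    moreover have "exp (- (t - s) * \<bar>\<xi>\<bar> powr \<alpha>) * exp (- (t' - s) * \<bar>\<xi>\<bar> powr \<alpha>)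
        = exp (- (t + t' - 2 * s) * \<bar>\<xi>\<bar> powr \<alpha>)"
      by (simp add: algebra_simps flip: exp_add)
    ultimately show ?thesis
      using True s unfolding F_def E_def FG_kernel_def
      by (simp add: cis_cnj mult_ac flip: of_real_mult)
  next
    case False
    then show ?thesis by (auto simp: F_def E_def FG_kernel_def m_def indicator_def)
  qed
  have E_int: "has_bochner_integral lborel (E \<xi>)
      ((exp (- \<bar>t - t'\<bar> * \<bar>\<xi>\<bar> powr \<alpha>) - exp (- (t + t') * \<bar>\<xi>\<bar> powr \<alpha>)) / (2 * \<bar>\<xi>\<bar> powr \<alpha>))" if "\<xi> \<noteq> 0" for \<xi>
    using has_bochner_integral_exp_Icc[OF m(1), of "\<bar>\<xi>\<bar> powr \<alpha>" "t + t'"] that m(2)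
    unfolding E_def by simp
  have weighted: "has_bochner_integral lborel (\<lambda>s. \<bar>\<xi>\<bar> powr (1 - 2 * H) * E \<xi> s)
     (\<bar>\<xi>\<bar> powr (- \<beta>) * (1 * (exp (- \<bar>t - t'\<bar> * \<bar>\<xi>\<bar> powr \<alpha>) - exp (- (t + t') * \<bar>\<xi>\<bar> powr \<alpha>)) / 2))"
    (is "has_bochner_integral _ _ (?g \<xi>)") for \<xi>
  \<comment> \<open>At \<xi> = 0 both sides are 0 because \<open>0 powr _\<close> is 0; division by
    |\<xi>|^\<alpha> takes place only in the other case.\<close>
  proof (cases "\<xi> = 0")
    case False
    have "1 - 2 * H - \<alpha> = - \<beta>" by (simp add: \<beta>_def)
    then have \<beta>: "\<bar>\<xi>\<bar> powr (- \<beta>) = \<bar>\<xi>\<bar> powr (1 - 2 * H) / \<bar>\<xi>\<bar> powr \<alpha>"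
      by (metis powr_diff)
    then show ?thesis
      using has_bochner_integral_mult_right[OF E_int[OF False], of "\<bar>\<xi>\<bar> powr (1 - 2 * H)"] False
      unfolding \<beta> by (simp add: mult.commute)
  qed (simp add: has_bochner_integral_zero)
  have norm_F: "norm (F \<xi> s) = \<bar>\<xi>\<bar> powr (1 - 2 * H) * E \<xi> s" for \<xi> s
    by (simp add: F_def E_def norm_mult del: cis.simps)
  have g_int: "integrable lborel ?g"
    using t integrable_heat_int[of "\<bar>t - t'\<bar>" "t + t'" "\<lambda>_. 1"] by auto
  have F_int_s: "has_bochner_integral lborel (F \<xi>) (cis (- \<xi> * (x - x')) * of_real (?g \<xi>))" for \<xi>
    unfolding F_def by (intro has_bochner_integral_mult_right has_bochner_integral_of_real weighted)
  have F_int: "integrable (lborel \<Otimes>\<^sub>M lborel) (\<lambda>(\<xi>, s). F \<xi> s)"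
  proof (rule lborel_pair.Fubini_integrable)
    have "indicator {0..m} s = (if 0 \<le> s \<and> s \<le> m then 1 else (0::real))" for s
      by (simp add: indicator_def)
    then show "(\<lambda>(\<xi>, s). F \<xi> s) \<in> borel_measurable (lborel \<Otimes>\<^sub>M lborel)"
      unfolding F_def E_def cis_conv_exp by simp
    show "integrable lborel (\<lambda>\<xi>. \<integral>s. norm ((\<lambda>(\<xi>, s). F \<xi> s) (\<xi>, s)) \<partial>lborel)"
      unfolding norm_F prod.case weighted[THEN has_bochner_integral_integral_eq] by (rule g_int)
    show "AE \<xi> in lborel. integrable lborel (\<lambda>s. (\<lambda>(\<xi>, s). F \<xi> s) (\<xi>, s))"
      unfolding prod.case using F_int_s[THEN integrable.intros] by simp
  qed
  have G_int: "integrable lborel (\<lambda>\<xi>. cis (- \<xi> * (x - x')) * of_real (?g \<xi>))"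
    using lborel_pair.integrable_fst[OF F_int]
    unfolding F_int_s[THEN has_bochner_integral_integral_eq] .
  have "(LINT s:{0..}|lborel. (LINT \<xi>|lborel. FG_kernel \<alpha> (t, x) s \<xi> * cnj (FG_kernel \<alpha> (t', x') s \<xi>) *
            complex_of_real (\<bar>\<xi>\<bar> powr (1 - 2 * H)))) = (\<integral>s. (\<integral>\<xi>. F \<xi> s \<partial>lborel) \<partial>lborel)"
    unfolding set_lebesgue_integral_def F_kernel[symmetric]
    by (intro Bochner_Integration.integral_cong refl) (auto simp: indicator_def)
  also have "\<dots> = (\<integral>\<xi>. (\<integral>s. F \<xi> s \<partial>lborel) \<partial>lborel)"
    by (rule lborel_pair.Fubini_integral[OF F_int])
  also have "\<dots> = (\<integral>\<xi>. cis (- \<xi> * (x - x')) * of_real (?g \<xi>) \<partial>lborel)"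
    unfolding F_int_s[THEN has_bochner_integral_integral_eq] ..
  finally have "u_cov \<alpha> H (t, x) (t', x')
      = c1H H * Re (\<integral>\<xi>. cis (- \<xi> * (x - x')) * of_real (?g \<xi>) \<partial>lborel)"
    unfolding u_cov_def by (simp only: Re_complex_of_real Im_complex_of_real times_complex.sel mult_zero_left diff_zero)
  also have "Re (\<integral>\<xi>. cis (- \<xi> * (x - x')) * of_real (?g \<xi>) \<partial>lborel)
      = (\<integral>\<xi>. Re (cis (- \<xi> * (x - x')) * of_real (?g \<xi>)) \<partial>lborel)"
    by (rule integral_Re[OF G_int, symmetric])
  also have "\<dots> = heat_int \<bar>t - t'\<bar> (t + t') (x - x')"
    unfolding heat_int_def
    by (intro Bochner_Integration.integral_cong refl) (simp add: mult_ac)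
  finally show ?thesis .
qed

lemma heat_int_scale:
  assumes k: "0 < k"
  shows "heat_int (k powr \<alpha> * \<tau>) (k powr \<alpha> * \<sigma>) (k * h) = k powr (\<beta> - 1) * heat_int \<tau> \<sigma> h"
  using k integral_powr_weight_scale[OF k, of \<beta> "\<lambda>\<xi>. cos (h * \<xi>) *
    (exp (- \<tau> * \<bar>\<xi>\<bar> powr \<alpha>) - exp (- \<sigma> * \<bar>\<xi>\<bar> powr \<alpha>)) / 2"]
  by (simp add: heat_int_def abs_mult powr_mult mult_ac)

lemma heat_int_abs_le:
  assumes "0 \<le> \<tau>" "\<tau> \<le> \<sigma>"
  shows "\<bar>heat_int \<tau> \<sigma> h\<bar> \<le> heat_int \<tau> \<sigma> 0"
proof -
  let ?d = "\<lambda>\<xi>. exp (- \<tau> * \<bar>\<xi>\<bar> powr \<alpha>) - exp (- \<sigma> * \<bar>\<xi>\<bar> powr \<alpha>)"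
  have "\<bar>heat_int \<tau> \<sigma> h\<bar> \<le> (\<integral>\<xi>. \<bar>\<bar>\<xi>\<bar> powr (- \<beta>) * (cos (h * \<xi>) * ?d \<xi> / 2)\<bar> \<partial>lborel)"
    unfolding heat_int_def by (rule integral_abs_bound)
  also have "\<dots> \<le> (\<integral>\<xi>. \<bar>\<xi>\<bar> powr (- \<beta>) * (cos (0 * \<xi>) * ?d \<xi> / 2) \<partial>lborel)"
  proof (intro integral_mono integrable_abs integrable_heat_int assms)
    fix \<xi> :: real
    have d: "0 \<le> ?d \<xi>" by (rule exp_diff_bounds[OF assms]) simp
    have "\<bar>\<bar>\<xi>\<bar> powr (- \<beta>) * (cos (h * \<xi>) * ?d \<xi> / 2)\<bar> = \<bar>\<xi>\<bar> powr (- \<beta>) * (\<bar>cos (h * \<xi>)\<bar> * ?d \<xi> / 2)"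
      using d by (simp add: abs_mult)
    also have "\<dots> \<le> \<bar>\<xi>\<bar> powr (- \<beta>) * (1 * ?d \<xi> / 2)"
      using d by (intro mult_left_mono divide_right_mono mult_right_mono) auto
    finally show "\<bar>\<bar>\<xi>\<bar> powr (- \<beta>) * (cos (h * \<xi>) * ?d \<xi> / 2)\<bar>
        \<le> \<bar>\<xi>\<bar> powr (- \<beta>) * (cos (0 * \<xi>) * ?d \<xi> / 2)" by simp
  qed auto
  finally show ?thesis by (simp add: heat_int_def)
qed

section \<open>Variance of the increments in space and time\<close>

definition cos_const :: real where
  "cos_const = (\<integral>\<xi>. \<bar>\<xi>\<bar> powr (- \<beta>) * (1 - cos \<xi>) \<partial>lborel)"

definition exp_const :: real where
  "exp_const = (\<integral>\<xi>. \<bar>\<xi>\<bar> powr (- \<beta>) * (1 - exp (- (\<bar>\<xi>\<bar> powr \<alpha>))) \<partial>lborel)"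

lemma cos_const_nonneg: "0 \<le> cos_const" and exp_const_nonneg: "0 \<le> exp_const"
  unfolding cos_const_def exp_const_def by (auto intro!: integral_nonneg)

text \<open>The natural bound near 0 is quadratic. As \<alpha> < 2, it can be weakened to
  |x|^\<alpha>, so that cosines and heat exponentials obey the same integrability criterion.\<close>

lemma one_minus_cos_weight: "1 - cos x \<le> 2 * min 1 (\<bar>x\<bar> powr \<alpha>)"
proof (cases "\<bar>x\<bar> \<le> 1")
  case True
  have "1 - cos x \<le> \<bar>x\<bar> powr 2"
    using one_minus_cos_le_power2[of x] zero_le_power2[of x] 
    unfolding powr_numeral[OF abs_ge_zero] power2_abs by linarith
  also have "\<dots> \<le> \<bar>x\<bar> powr \<alpha>"
    using True \<alpha>2 by (intro powr_mono') auto
  finally have "1 - cos x \<le> \<bar>x\<bar> powr \<alpha>" .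
  moreover have "\<bar>x\<bar> powr \<alpha> \<le> 1" using True \<alpha>1 by (intro powr_le1) auto
  ultimately show ?thesis
    using powr_ge_zero[of "\<bar>x\<bar>" \<alpha>] by (simp only: min_absorb2)
next
  case False
  then have "1 \<le> \<bar>x\<bar> powr \<alpha>" using \<alpha>1 by (intro ge_one_powr_ge_zero) auto
  then show ?thesis using cos_ge_minus_one[of x] by simp
qed

lemma integrable_one_minus_cos:
  "integrable lborel (\<lambda>\<xi>. \<bar>\<xi>\<bar> powr (- \<beta>) * (1 - cos (h * \<xi>)))"
proof (rule integrable_weight[where C = "2 * max 1 (\<bar>h\<bar> powr \<alpha>)"])
  fix x
  have "1 - cos (h * x) \<le> 2 * min 1 (\<bar>h * x\<bar> powr \<alpha>)" by (rule one_minus_cos_weight)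
  also have "\<bar>h * x\<bar> powr \<alpha> = \<bar>h\<bar> powr \<alpha> * \<bar>x\<bar> powr \<alpha>" by (simp add: abs_mult powr_mult)
  also have "2 * min 1 (\<bar>h\<bar> powr \<alpha> * \<bar>x\<bar> powr \<alpha>) \<le> 2 * (max 1 (\<bar>h\<bar> powr \<alpha>) * min 1 (\<bar>x\<bar> powr \<alpha>))"
  proof -
    have "\<bar>h\<bar> powr \<alpha> * \<bar>x\<bar> powr \<alpha> \<le> max 1 (\<bar>h\<bar> powr \<alpha>) * \<bar>x\<bar> powr \<alpha>"
      by (intro mult_right_mono) auto
    moreover have "min 1 (\<bar>h\<bar> powr \<alpha> * \<bar>x\<bar> powr \<alpha>) \<le> max 1 (\<bar>h\<bar> powr \<alpha>)" by linarith
    ultimately show ?thesis by (auto simp: min_def split: if_splits)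
  qed
  finally show "\<bar>1 - cos (h * x)\<bar> \<le> 2 * max 1 (\<bar>h\<bar> powr \<alpha>) * min 1 (\<bar>x\<bar> powr \<alpha>)"
    by (simp add: mult.assoc)
qed measurable

lemma integrable_one_minus_exp:
  assumes "0 \<le> \<tau>"
  shows "integrable lborel (\<lambda>\<xi>. \<bar>\<xi>\<bar> powr (- \<beta>) * (1 - exp (- \<tau> * \<bar>\<xi>\<bar> powr \<alpha>)))"
proof (rule integrable_weight)
  fix \<xi>
  show "\<bar>1 - exp (- \<tau> * \<bar>\<xi>\<bar> powr \<alpha>)\<bar> \<le> max 1 \<tau> * min 1 (\<bar>\<xi>\<bar> powr \<alpha>)"
    using one_minus_exp_le[OF assms, of "\<bar>\<xi>\<bar> powr \<alpha>"] assms by simp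
qed measurable

lemma integral_one_minus_cos:
  "(\<integral>\<xi>. \<bar>\<xi>\<bar> powr (- \<beta>) * (1 - cos (h * \<xi>)) \<partial>lborel) = \<bar>h\<bar> powr (\<beta> - 1) * cos_const"
proof (cases "h = 0")
  case False
  \<comment> \<open>The scaling lemma asks for a positive factor; the cosine is even.\<close>
  have "cos (h * \<xi>) = cos (\<bar>h\<bar> * \<xi>)" for \<xi> by (auto simp: abs_if)
  then show ?thesis
    using False integral_powr_weight_scale[of "\<bar>h\<bar>" \<beta> "\<lambda>\<xi>. 1 - cos \<xi>"]
    by (simp add: cos_const_def)
qed simp

lemma integral_one_minus_exp:
  assumes "0 \<le> \<tau>"
  shows "(\<integral>\<xi>. \<bar>\<xi>\<bar> powr (- \<beta>) * (1 - exp (- \<tau> * \<bar>\<xi>\<bar> powr \<alpha>)) \<partial>lborel)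
    = \<tau> powr ((\<beta> - 1) / \<alpha>) * exp_const"
proof (cases "\<tau> = 0")
  case False
  then have "0 < \<tau> powr (1 / \<alpha>)" using assms by simp
  moreover have "(\<tau> powr (1 / \<alpha>)) powr \<alpha> = \<tau>" using \<alpha>1 assms by (simp add: powr_powr)
  ultimately show ?thesis
    using integral_powr_weight_scale[of "\<tau> powr (1 / \<alpha>)" \<beta> "\<lambda>\<xi>. 1 - exp (- (\<bar>\<xi>\<bar> powr \<alpha>))"]
    by (simp add: exp_const_def abs_mult powr_mult powr_powr)
qed simp

text \<open>Here w stands for |\<xi>|^\<alpha> and \<theta> for the cosine of the spatial phase.
  With a = exp(-t w) and q = exp(-(t' - t) w) the left-hand side equals q (1 - a^2)(1 - \<theta>) +
  (1 - q) - a^2 (1 - q)^2 / 2. Space and time separate, and the resulting bound depends on the times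
  only through t' - t.\<close>

lemma increment_integrand_le:
  fixes t t' w \<theta> :: real
  assumes "0 \<le> t" "t \<le> t'" "0 \<le> w" "\<bar>\<theta>\<bar> \<le> 1"
  shows "(1 - exp (- (2 * t) * w)) / 2 + (1 - exp (- (2 * t') * w)) / 2
     - \<theta> * (exp (- (t' - t) * w) - exp (- (t + t') * w)) \<le> (1 - \<theta>) + (1 - exp (- (t' - t) * w))"
proof -
  define a where "a = exp (- t * w)"
  define q where "q = exp (- (t' - t) * w)"
  have a: "0 < a" "a \<le> 1" and q: "0 < q" "q \<le> 1" using assms by (auto simp: a_def q_def mult_nonpos_nonneg)
  have e1: "exp (- (2 * t) * w) = a\<^sup>2" and e2: "exp (- (2 * t') * w) = a\<^sup>2 * q\<^sup>2"
    and e3: "exp (- (t + t') * w) = a\<^sup>2 * q"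
    by (simp_all add: a_def q_def power2_eq_square algebra_simps flip: exp_add)
  have "a\<^sup>2 \<le> 1" using a by (simp add: power_le_one)
  have "q * (1 - a\<^sup>2) * (1 - \<theta>) \<le> 1 * (1 - \<theta>)"
    using assms a q \<open>a\<^sup>2 \<le> 1\<close> by (intro mult_right_mono mult_le_one) auto
  moreover have "0 \<le> a\<^sup>2 * (1 - q)\<^sup>2 / 2" by simp
  moreover have "(1 - a\<^sup>2) / 2 + (1 - a\<^sup>2 * q\<^sup>2) / 2 - \<theta> * (q - a\<^sup>2 * q)
      = q * (1 - a\<^sup>2) * (1 - \<theta>) + (1 - q) - a\<^sup>2 * (1 - q)\<^sup>2 / 2"
    by (simp add: power2_eq_square field_simps)
  moreover have "L \<le> c + d" if "P \<le> 1 * c" "0 \<le> R" "L = P + d - R" for L P R c d :: real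
    using that by linarith
  ultimately show ?thesis
    unfolding e1 e2 e3 q_def[symmetric] by blast
qed

text \<open>The variance of \<open>u p - u q\<close>, that is, the squared canonical distance of the
  chaining argument.\<close>

definition incr :: "real \<times> real \<Rightarrow> real \<times> real \<Rightarrow> real" where
  "incr p q = u_cov \<alpha> H p p + u_cov \<alpha> H q q - 2 * u_cov \<alpha> H p q"

definition incr_const :: real where
  "incr_const = c1H H * (cos_const + exp_const)"

lemma incr_const_nonneg: "0 \<le> incr_const"
  using c1H_pos cos_const_nonneg exp_const_nonneg by (simp add: incr_const_def)

lemma u_cov_commute:
  assumes "0 \<le> t" "0 \<le> t'"
  shows "u_cov \<alpha> H (t, x) (t', x') = u_cov \<alpha> H (t', x') (t, x)"
proof -
  have "heat_int \<tau> \<sigma> (x - y) = heat_int \<tau> \<sigma> (y - x)" for \<tau> \<sigma> x y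
  proof -
    have "cos ((x - y) * \<xi>) = cos ((y - x) * \<xi>)" for \<xi>
      using cos_minus[of "(x - y) * \<xi>"] by (simp add: algebra_simps)
    then show ?thesis by (simp add: heat_int_def)
  qed
  from this[of _ _ x x'] show ?thesis
    unfolding u_cov_eq[OF assms] u_cov_eq[OF assms(2,1)] abs_minus_commute[of t' t] add.commute[of t' t]
    by simp
qed

lemma incr_commute:
  assumes "0 \<le> t" "0 \<le> t'"
  shows "incr (t, x) (t', x') = incr (t', x') (t, x)"
  unfolding incr_def u_cov_commute[OF assms] by simp

text \<open>The pointwise bound is integrated against |\<xi>|^(-\<beta>), and scaling evaluates its
  two parts. The proof orders the times first and removes this by symmetry.\<close>

lemma incr_le:
  assumes t: "0 \<le> t" "0 \<le> t'"
  shows "incr (t, x) (t', x')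
    \<le> incr_const * (\<bar>t - t'\<bar> powr ((\<beta> - 1) / \<alpha>) + \<bar>x - x'\<bar> powr (\<beta> - 1))"
proof -
  have main: "incr (t, x) (t', x')
      \<le> c1H H * (\<bar>x - x'\<bar> powr (\<beta> - 1) * cos_const + (t' - t) powr ((\<beta> - 1) / \<alpha>) * exp_const)"
    if t: "0 \<le> t" "t \<le> t'" for t t' x x'
  proof -
    let ?w = "\<lambda>\<xi>::real. \<bar>\<xi>\<bar> powr \<alpha>"
    let ?f = "\<lambda>\<tau> \<sigma> h \<xi>. \<bar>\<xi>\<bar> powr (- \<beta>) * (cos (h * \<xi>) * (exp (- \<tau> * ?w \<xi>) - exp (- \<sigma> * ?w \<xi>)) / 2)"
    let ?g = "\<lambda>\<xi>. \<bar>\<xi>\<bar> powr (- \<beta>) * (1 - cos ((x - x') * \<xi>)) + \<bar>\<xi>\<bar> powr (- \<beta>) * (1 - exp (- (t' - t) * ?w \<xi>))"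
    have lhs: "has_bochner_integral lborel
        (\<lambda>\<xi>. ?f 0 (2 * t) 0 \<xi> + ?f 0 (2 * t') 0 \<xi> - 2 * ?f (t' - t) (t + t') (x - x') \<xi>)
        (heat_int 0 (2 * t) 0 + heat_int 0 (2 * t') 0 - 2 * heat_int (t' - t) (t + t') (x - x'))"
    proof -
      have i1: "has_bochner_integral lborel (?f 0 (2 * t) 0) (heat_int 0 (2 * t) 0)"
        using t by (intro has_bochner_integral_heat_int) simp_all
      have i2: "has_bochner_integral lborel (?f 0 (2 * t') 0) (heat_int 0 (2 * t') 0)"
        using t by (intro has_bochner_integral_heat_int) simp_all
      have i3: "has_bochner_integral lborel (?f (t' - t) (t + t') (x - x')) (heat_int (t' - t) (t + t') (x - x'))"
        using t by (intro has_bochner_integral_heat_int) simp_all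
      show ?thesis
        by (rule has_bochner_integral_diff[OF has_bochner_integral_add[OF i1 i2]
              has_bochner_integral_mult_right[OF i3]])
    qed
    have rhs: "has_bochner_integral lborel ?g
        (\<bar>x - x'\<bar> powr (\<beta> - 1) * cos_const + (t' - t) powr ((\<beta> - 1) / \<alpha>) * exp_const)"
    proof (rule has_bochner_integral_add)
      show "has_bochner_integral lborel (\<lambda>\<xi>. \<bar>\<xi>\<bar> powr (- \<beta>) * (1 - cos ((x - x') * \<xi>)))
          (\<bar>x - x'\<bar> powr (\<beta> - 1) * cos_const)"
        unfolding has_bochner_integral_iff
        by (intro conjI integrable_one_minus_cos integral_one_minus_cos)
      show "has_bochner_integral lborel (\<lambda>\<xi>. \<bar>\<xi>\<bar> powr (- \<beta>) * (1 - exp (- (t' - t) * ?w \<xi>)))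
          ((t' - t) powr ((\<beta> - 1) / \<alpha>) * exp_const)"
        unfolding has_bochner_integral_iff using t
        by (intro conjI integrable_one_minus_exp integral_one_minus_exp) simp_all
    qed
    have le: "?f 0 (2 * t) 0 \<xi> + ?f 0 (2 * t') 0 \<xi> - 2 * ?f (t' - t) (t + t') (x - x') \<xi> \<le> ?g \<xi>" for \<xi>
    proof -
      have "\<bar>\<xi>\<bar> powr (- \<beta>) * ((1 - exp (- (2 * t) * ?w \<xi>)) / 2 + (1 - exp (- (2 * t') * ?w \<xi>)) / 2
         - cos ((x - x') * \<xi>) * (exp (- (t' - t) * ?w \<xi>) - exp (- (t + t') * ?w \<xi>)))
        \<le> \<bar>\<xi>\<bar> powr (- \<beta>) * ((1 - cos ((x - x') * \<xi>)) + (1 - exp (- (t' - t) * ?w \<xi>)))"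
        using t by (intro mult_left_mono increment_integrand_le) auto
      moreover have "p * (cos (0 * \<xi>) * (exp (- 0 * W) - A) / 2) + p * (cos (0 * \<xi>) * (exp (- 0 * W) - B) / 2)
          - 2 * (p * (c * d / 2)) = p * ((1 - A) / 2 + (1 - B) / 2 - c * d)" for p W A B c d :: real
        by (simp add: algebra_simps)
      ultimately show ?thesis by (simp only: distrib_left)
    qed
    have "incr (t, x) (t', x')
        = c1H H * (heat_int 0 (2 * t) 0 + heat_int 0 (2 * t') 0 - 2 * heat_int (t' - t) (t + t') (x - x'))"
      using t by (simp add: incr_def u_cov_eq algebra_simps)
    also have "heat_int 0 (2 * t) 0 + heat_int 0 (2 * t') 0 - 2 * heat_int (t' - t) (t + t') (x - x')
        \<le> \<bar>x - x'\<bar> powr (\<beta> - 1) * cos_const + (t' - t) powr ((\<beta> - 1) / \<alpha>) * exp_const"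
      by (rule has_bochner_integral_mono[OF lhs rhs le])
    finally show ?thesis
      using c1H_pos by (auto intro: mult_left_mono)
  qed
  have "incr (t, x) (t', x')
      \<le> c1H H * (\<bar>x - x'\<bar> powr (\<beta> - 1) * cos_const + \<bar>t - t'\<bar> powr ((\<beta> - 1) / \<alpha>) * exp_const)"
  proof (cases "t \<le> t'")
    case True
    then show ?thesis using main[OF t(1) True, of x x'] by simp
  next
    case False
    then show ?thesis
      using main[OF t(2), of t x' x] incr_commute[OF t] False by (simp add: abs_minus_commute)
  qed
  also have "\<dots> \<le> c1H H * ((cos_const + exp_const) * (\<bar>t - t'\<bar> powr ((\<beta> - 1) / \<alpha>) + \<bar>x - x'\<bar> powr (\<beta> - 1)))"
    using c1H_pos cos_const_nonneg exp_const_nonneg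
    by (intro mult_left_mono) (auto simp: algebra_simps)
  finally show ?thesis by (simp add: incr_const_def mult.assoc)
qed

section \<open>Spatial covariance at time 1: spectral gap and decay\<close>

definition gap_const :: real where
  "gap_const = 3 powr (- \<beta>) * (1 - exp (- 2)) / 2"

lemma gap_const_pos: "0 < gap_const"
  by (simp add: gap_const_def)

text \<open>On [1,3] the spectral density is at least \<open>gap_const\<close>, and 1 - cos(h \<xi>)
  is nonnegative everywhere, so the integral may be cut down to [1,3]. There 1 - cos(h \<xi>)
  integrates to 2 minus a quantity that is at most 2/h, hence to at least 1.\<close>

lemma heat_int_gap:
  assumes h: "2 \<le> h"
  shows "gap_const \<le> heat_int 0 2 0 - heat_int 0 2 h"
proof -
  let ?f = "\<lambda>\<xi>. gap_const * (1 - cos (h * \<xi>))"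
  let ?F = "\<lambda>\<xi>. gap_const * (\<xi> - sin (h * \<xi>) / h)"
  have "integral\<^sup>L lborel (\<lambda>\<xi>. indicator {1..3} \<xi> *\<^sub>R ?f \<xi>) = ?F 3 - ?F 1"
    using h by (intro integral_FTC_atLeastAtMost)
      (auto intro!: derivative_eq_intros continuous_intros simp flip: has_real_derivative_iff_has_vector_derivative)
  moreover have "set_integrable lborel {1..3} ?f"
    by (intro borel_integrable_atLeastAtMost' continuous_intros)
  ultimately have lower: "has_bochner_integral lborel (\<lambda>\<xi>. indicator {1..3} \<xi> *\<^sub>R ?f \<xi>) (?F 3 - ?F 1)"
    by (simp only: has_bochner_integral_iff set_integrable_def simp_thms)
  have "1 \<le> 2 - (sin (h * 3) - sin (h * 1)) / h"
  proof -
    have "sin (h * 3) - sin (h * 1) \<le> 2"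
      using sin_le_one[of "h * 3"] sin_ge_minus_one[of "h * 1"] by linarith
    then have "(sin (h * 3) - sin (h * 1)) / h \<le> 1"
      using h by (simp add: divide_le_eq)
    then show ?thesis by simp
  qed
  then have "gap_const * 1 \<le> gap_const * (2 - (sin (h * 3) - sin (h * 1)) / h)"
    using gap_const_pos by (intro mult_left_mono) auto
  also have "\<dots> = ?F 3 - ?F 1" by (simp add: algebra_simps diff_divide_distrib)
  also have "\<dots> \<le> heat_int 0 2 0 - heat_int 0 2 h"
  proof (rule has_bochner_integral_mono[OF lower has_bochner_integral_diff[OF has_bochner_integral_heat_int has_bochner_integral_heat_int]])
    fix \<xi> :: real
    let ?d = "exp (- 0 * \<bar>\<xi>\<bar> powr \<alpha>) - exp (- 2 * \<bar>\<xi>\<bar> powr \<alpha>)"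
    have d: "0 \<le> ?d" by (rule exp_diff_bounds) auto
    have eq: "\<bar>\<xi>\<bar> powr (- \<beta>) * (cos (0 * \<xi>) * ?d / 2) - \<bar>\<xi>\<bar> powr (- \<beta>) * (cos (h * \<xi>) * ?d / 2)
        = (\<bar>\<xi>\<bar> powr (- \<beta>) * ?d / 2) * (1 - cos (h * \<xi>))"
    proof -
      have "p * (cos (0 * \<xi>) * d / 2) - p * (c * d / 2) = p * d / 2 * (1 - c)" for p c d :: real
        by (simp add: field_simps)
      then show ?thesis .
    qed
    show "indicator {1..3} \<xi> *\<^sub>R ?f \<xi> \<le>
        \<bar>\<xi>\<bar> powr (- \<beta>) * (cos (0 * \<xi>) * ?d / 2) - \<bar>\<xi>\<bar> powr (- \<beta>) * (cos (h * \<xi>) * ?d / 2)"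
    proof (cases "1 \<le> \<xi> \<and> \<xi> \<le> 3")
      case True
      have "3 powr (- \<beta>) \<le> \<bar>\<xi>\<bar> powr (- \<beta>)"
        using True \<beta>1 by (intro powr_mono2') auto
      moreover have "1 - exp (- 2) \<le> ?d"
        using True \<alpha>1 by (simp add: ge_one_powr_ge_zero)
      ultimately have "gap_const \<le> \<bar>\<xi>\<bar> powr (- \<beta>) * ?d / 2"
        unfolding gap_const_def by (intro divide_right_mono mult_mono) auto
      then have "gap_const * (1 - cos (h * \<xi>)) \<le> \<bar>\<xi>\<bar> powr (- \<beta>) * ?d / 2 * (1 - cos (h * \<xi>))"
        by (rule mult_right_mono) simp
      then show ?thesis
        unfolding eq using True by (simp only: indicator_simps atLeastAtMost_iff scaleR_one)
    next
      case False
      then show ?thesis unfolding eq using d by (auto simp del: mult_minus_left)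
    qed
  qed simp_all
  finally show ?thesis by simp
qed

text \<open>The value at lag 2 is at least minus the value at lag 0, so the gap between them is at
  most twice the value at lag 0.\<close>

lemma heat_int_0_2_pos: "gap_const / 2 \<le> heat_int 0 2 0"
  using heat_int_gap[of 2] heat_int_abs_le[of 0 2 2] by linarith

text \<open>The factor \<alpha> + \<beta> stems from differentiating the density, the 2 from the two
  half-lines. The integral converges at 0 because \<beta> < \<alpha>.\<close>

definition decay_const :: real where
  "decay_const = 2 * (\<alpha> + \<beta>) * (\<integral>\<xi>. \<bar>\<xi>\<bar> powr (- (\<beta> + 1)) * min 1 (\<bar>\<xi>\<bar> powr \<alpha>) \<partial>lborel)"

lemma decay_const_nonneg: "0 \<le> decay_const"
  unfolding decay_const_def using \<alpha>1 \<beta>1 by (intro mult_nonneg_nonneg integral_nonneg) auto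

text \<open>Integration by parts against the spectral density, whose derivative is integrable.\<close>
lemma heat_int_decay:
  assumes h: "0 < h"
  shows "\<bar>heat_int 0 2 h\<bar> \<le> decay_const / h"
proof -
  \<comment> \<open>\<open>A\<close> is the cosine integrand and \<open>F\<close> is sin(h \<xi>)/h
    times the spectral density. On the positive half-line F' = A + B, where \<open>B\<close> carries
    the derivative of the density: in \<open>\<psi>\<close> the term with \<alpha> comes from the
    exponential and the term with \<beta> from the power.\<close>
  define A where "A \<xi> = \<bar>\<xi>\<bar> powr (- \<beta>) * (cos (h * \<xi>) * (exp (- 0 * \<bar>\<xi>\<bar> powr \<alpha>) - exp (- 2 * \<bar>\<xi>\<bar> powr \<alpha>)) / 2)" for \<xi>
  define \<psi> where "\<psi> \<xi> = sin (h * \<xi>) / h * (\<alpha> * (\<bar>\<xi>\<bar> powr \<alpha> * exp (- 2 * \<bar>\<xi>\<bar> powr \<alpha>)) -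
      \<beta> * ((1 - exp (- 2 * \<bar>\<xi>\<bar> powr \<alpha>)) / 2))" for \<xi>
  define B where "B \<xi> = \<bar>\<xi>\<bar> powr (- (\<beta> + 1)) * \<psi> \<xi>" for \<xi>
  define F where "F \<xi> = sin (h * \<xi>) / h * (\<xi> powr (- \<beta>) * ((1 - exp (- 2 * \<xi> powr \<alpha>)) / 2))" for \<xi>
  have A: "has_bochner_integral lborel A (heat_int 0 2 h)"
    unfolding A_def by (rule has_bochner_integral_heat_int) auto
  have \<psi>: "\<bar>\<psi> \<xi>\<bar> \<le> (\<alpha> + \<beta>) / h * min 1 (\<bar>\<xi>\<bar> powr \<alpha>)" for \<xi>
  proof -
    let ?w = "\<bar>\<xi>\<bar> powr \<alpha>"
    have w: "0 \<le> ?w" by simp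
    have e: "?w * exp (- 2 * ?w) \<le> min 1 ?w"
    proof -
      have "?w \<le> exp (2 * ?w)" using exp_ge_add_one_self[of "2 * ?w"] w by linarith
      then have "?w * exp (- 2 * ?w) \<le> exp (2 * ?w) * exp (- 2 * ?w)" by (intro mult_right_mono) auto
      then have "?w * exp (- 2 * ?w) \<le> 1" by (simp flip: exp_add)
      moreover have "?w * exp (- 2 * ?w) \<le> ?w * 1" by (intro mult_left_mono) auto
      ultimately show ?thesis by simp
    qed
    have e': "(1 - exp (- 2 * ?w)) / 2 \<le> min 1 ?w" "0 \<le> (1 - exp (- 2 * ?w)) / 2"
      using one_minus_exp_le[of 2 ?w] by auto
    have "\<bar>\<alpha> * (?w * exp (- 2 * ?w)) - \<beta> * ((1 - exp (- 2 * ?w)) / 2)\<bar>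
        \<le> \<bar>\<alpha> * (?w * exp (- 2 * ?w))\<bar> + \<bar>\<beta> * ((1 - exp (- 2 * ?w)) / 2)\<bar>" by (rule abs_triangle_ineq4)
    also have "\<dots> = \<alpha> * (?w * exp (- 2 * ?w)) + \<beta> * ((1 - exp (- 2 * ?w)) / 2)"
      using \<alpha>1 \<beta>1 e'(2) by (simp only: abs_mult) simp
    also have "\<dots> \<le> \<alpha> * min 1 ?w + \<beta> * min 1 ?w"
      using \<alpha>1 \<beta>1 e e' by (intro add_mono mult_left_mono) auto
    finally have r: "\<bar>\<alpha> * (?w * exp (- 2 * ?w)) - \<beta> * ((1 - exp (- 2 * ?w)) / 2)\<bar> \<le> (\<alpha> + \<beta>) * min 1 ?w"
      by (simp only: distrib_right)
    have "\<bar>sin (h * \<xi>) / h\<bar> \<le> 1 / h" using h by (simp add: divide_right_mono)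
    then have "\<bar>\<psi> \<xi>\<bar> \<le> 1 / h * ((\<alpha> + \<beta>) * min 1 ?w)"
      unfolding \<psi>_def abs_mult[of "sin (h * \<xi>) / h"] using r h by (intro mult_mono) auto
    then show ?thesis by (simp only: times_divide_eq_left mult_1 times_divide_eq_right)
  qed
  have B: "integrable lborel B"
    unfolding B_def
  proof (rule integrable_powr_weight[OF _ _ _ \<psi>])
    show "1 < \<beta> + 1" "\<beta> + 1 < 1 + \<alpha>" using \<beta>1 \<beta>\<alpha> by auto
    show "\<psi> \<in> borel_measurable borel" unfolding \<psi>_def by measurable
  qed
  have F_deriv: "DERIV F \<xi> :> A \<xi> + B \<xi>" if "0 < \<xi>" for \<xi>
  proof -
    have D1: "DERIV (\<lambda>\<xi>. sin (h * \<xi>) / h) \<xi> :> cos (h * \<xi>)"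
      using h by (auto intro!: derivative_eq_intros)
    have D2: "DERIV (\<lambda>\<xi>. \<xi> powr (- \<beta>)) \<xi> :> - \<beta> * \<xi> powr (- \<beta> - 1)"
      using that by (auto intro!: derivative_eq_intros)
    have D3: "DERIV (\<lambda>\<xi>. (1 - exp (- 2 * \<xi> powr \<alpha>)) / 2) \<xi> :> \<alpha> * \<xi> powr (\<alpha> - 1) * exp (- 2 * \<xi> powr \<alpha>)"
      using that by (auto intro!: derivative_eq_intros)
    have "DERIV F \<xi> :> cos (h * \<xi>) * (\<xi> powr (- \<beta>) * ((1 - exp (- 2 * \<xi> powr \<alpha>)) / 2))
      + (- \<beta> * \<xi> powr (- \<beta> - 1) * ((1 - exp (- 2 * \<xi> powr \<alpha>)) / 2)
         + \<alpha> * \<xi> powr (\<alpha> - 1) * exp (- 2 * \<xi> powr \<alpha>) * \<xi> powr (- \<beta>)) * (sin (h * \<xi>) / h)"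
      unfolding F_def by (intro DERIV_mult D1 D2 D3)
    moreover have "\<xi> powr (- \<beta>) * \<xi> powr (\<alpha> - 1) = \<xi> powr (- \<beta> - 1) * \<xi> powr \<alpha>"
      by (simp add: algebra_simps flip: powr_add)
    moreover have "c * (p * ((1 - x) / 2)) + (- \<beta> * q * ((1 - x) / 2) + \<alpha> * r * x * p) * s
        = p * (c * (1 - x) / 2) + q * (s * (\<alpha> * (w * x) - \<beta> * ((1 - x) / 2)))"
      if "p * r = q * w" for c p x q r w s :: real
    proof -
      have "\<alpha> * r * x * p * s = \<alpha> * x * s * (q * w)" unfolding that[symmetric] by simp
      then show ?thesis by (simp add: field_simps)
    qed
    moreover have "- (\<beta> + 1) = - \<beta> - 1" by simp
    ultimately show ?thesis
      using that unfolding A_def B_def \<psi>_def by (simp only: abs_of_pos minus_zero mult_zero_left exp_zero)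
  qed
  have cont: "isCont (\<lambda>\<xi>. A \<xi> + B \<xi>) \<xi>" if "0 < \<xi>" for \<xi>
    unfolding A_def B_def \<psi>_def using that h by (intro continuous_intros) auto
  \<comment> \<open>Near 0 the sine factor is at most \<xi> and the density at most \<xi>^(\<alpha>
    - \<beta>); at infinity \<open>F\<close> is O(\<xi>^(-\<beta>)). Both boundary terms vanish, so
    the integrals of \<open>A\<close> and \<open>B\<close> over the half-line are opposite.\<close>
  have F_0: "(F \<longlongrightarrow> 0) (at_right 0)"
  proof (rule Lim_null_comparison)
    show "eventually (\<lambda>\<xi>. norm (F \<xi>) \<le> \<xi> powr (1 + \<alpha> - \<beta>)) (at_right 0)"
    proof (intro eventually_at_rightI[of 0 1])
      fix \<xi> :: real assume "\<xi> \<in> {0<..<1}"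
      then have \<xi>: "0 < \<xi>" by simp
      have s: "\<bar>sin (h * \<xi>) / h\<bar> \<le> \<xi>"
        using abs_sin_x_le_abs_x[of "h * \<xi>"] h \<xi> by (simp add: abs_mult divide_le_eq mult.commute)
      have "1 - exp (- 2 * \<xi> powr \<alpha>) \<le> 2 * \<xi> powr \<alpha>"
        using exp_ge_add_one_self[of "- 2 * \<xi> powr \<alpha>"] by simp
      then have e: "\<bar>(1 - exp (- 2 * \<xi> powr \<alpha>)) / 2\<bar> \<le> \<xi> powr \<alpha>" by simp
      have "\<bar>F \<xi>\<bar> \<le> \<xi> * (\<xi> powr (- \<beta>) * \<xi> powr \<alpha>)"
        unfolding F_def abs_mult[of "sin (h * \<xi>) / h"] abs_mult[of "\<xi> powr (- \<beta>)"]
        using s e \<xi> by (intro mult_mono) auto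
      also have "\<dots> = \<xi> powr (1 + \<alpha> - \<beta>)"
        using \<xi> by (simp add: powr_diff powr_add powr_minus field_simps)
      finally show "norm (F \<xi>) \<le> \<xi> powr (1 + \<alpha> - \<beta>)" by simp
    qed simp
    show "((\<lambda>\<xi>. \<xi> powr (1 + \<alpha> - \<beta>)) \<longlongrightarrow> 0) (at_right 0)"
      using \<beta>\<alpha> by real_asymp
  qed
  have F_top: "(F \<longlongrightarrow> 0) at_top"
  proof (rule Lim_null_comparison)
    show "eventually (\<lambda>\<xi>. norm (F \<xi>) \<le> 1 / h * \<xi> powr (- \<beta>)) at_top"
    proof (intro eventually_mono[OF eventually_gt_at_top[of 0]])
      fix \<xi> :: real assume \<xi>: "0 < \<xi>"
      have s: "\<bar>sin (h * \<xi>) / h\<bar> \<le> 1 / h" using h by (simp add: divide_right_mono)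
      have half: "\<bar>(1 - z) / 2\<bar> \<le> 1" if "0 \<le> z" "z \<le> 1" for z :: real
        using that by (simp add: abs_le_iff)
      have e: "\<bar>(1 - exp (- 2 * \<xi> powr \<alpha>)) / 2\<bar> \<le> 1" by (rule half) simp_all
      have "\<bar>F \<xi>\<bar> \<le> 1 / h * (\<xi> powr (- \<beta>) * 1)"
        unfolding F_def abs_mult[of "sin (h * \<xi>) / h"] abs_mult[of "\<xi> powr (- \<beta>)"]
        using s e \<xi> h by (intro mult_mono) auto
      then show "norm (F \<xi>) \<le> 1 / h * \<xi> powr (- \<beta>)" by simp
    qed
    show "((\<lambda>\<xi>. 1 / h * \<xi> powr (- \<beta>)) \<longlongrightarrow> 0) at_top"
      using \<beta>1 by real_asymp
  qed
  have "(LBINT \<xi>=ereal 0..\<infinity>. A \<xi> + B \<xi>) = 0 - 0"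
  proof (rule interval_integral_FTC_integrable)
    show "(F has_vector_derivative A \<xi> + B \<xi>) (at \<xi>)" if "ereal 0 < ereal \<xi>" for \<xi>
      using F_deriv that by (simp flip: has_real_derivative_iff_has_vector_derivative)
    show "isCont (\<lambda>\<xi>. A \<xi> + B \<xi>) \<xi>" if "ereal 0 < ereal \<xi>" for \<xi>
      using cont that by simp
    have "set_integrable lborel UNIV (\<lambda>\<xi>. A \<xi> + B \<xi>)"
      using A B by (simp add: set_integrable_def has_bochner_integral_iff)
    then show "set_integrable lborel (einterval (ereal 0) \<infinity>) (\<lambda>\<xi>. A \<xi> + B \<xi>)"
      by (rule set_integrable_subset) auto
    show "((F \<circ> real_of_ereal) \<longlongrightarrow> 0) (at_right (ereal 0))"
      using F_0 by (simp add: ereal_tendsto_simps)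
    show "((F \<circ> real_of_ereal) \<longlongrightarrow> 0) (at_left \<infinity>)"
      using F_top by (simp add: ereal_tendsto_simps)
  qed simp
  note FTC = this
  have zero: "(\<integral>\<xi>. indicator {0<..} \<xi> * (A \<xi> + B \<xi>) \<partial>lborel) = 0"
  proof -
    have "einterval (ereal 0) \<infinity> = {0<..}" by (auto simp: einterval_iff)
    moreover have "ereal 0 \<le> \<infinity>" by simp
    ultimately show ?thesis
      using FTC
      by (simp only: interval_lebesgue_integral_def set_lebesgue_integral_def real_scaleR_def if_True diff_self)
  qed
  have iA: "integrable lborel (\<lambda>\<xi>. indicator {0<..} \<xi> * A \<xi>)"
    using integrable_real_mult_indicator[of "{0<..}" lborel A] A by (simp add: has_bochner_integral_iff mult.commute)
  have iB: "integrable lborel (\<lambda>\<xi>. indicator {0<..} \<xi> * B \<xi>)"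
    using integrable_real_mult_indicator[of "{0<..}" lborel B] B by (simp add: mult.commute)
  have AB: "(\<integral>\<xi>. indicator {0<..} \<xi> * A \<xi> \<partial>lborel) = - (\<integral>\<xi>. indicator {0<..} \<xi> * B \<xi> \<partial>lborel)"
    using zero iA iB by (simp add: distrib_left)
  have "has_bochner_integral lborel A (2 *\<^sub>R (\<integral>\<xi>. indicator {0<..} \<xi> * A \<xi> \<partial>lborel))"
  proof (rule has_bochner_integral_even_function)
    \<comment> \<open>\<open>A 0\<close> is 0 because \<open>0 powr _\<close> is 0, so the closed
      and the open half-line give the same function.\<close>
    have "(\<lambda>\<xi>. indicator {0..} \<xi> *\<^sub>R A \<xi>) = (\<lambda>\<xi>. indicator {0<..} \<xi> * A \<xi>)"
      by (auto simp: fun_eq_iff indicator_def A_def)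
    then show "has_bochner_integral lborel (\<lambda>\<xi>. indicator {0..} \<xi> *\<^sub>R A \<xi>) (\<integral>\<xi>. indicator {0<..} \<xi> * A \<xi> \<partial>lborel)"
      using iA by (simp add: has_bochner_integral_iff)
    show "A (- \<xi>) = A \<xi>" for \<xi> by (simp add: A_def)
  qed
  then have "heat_int 0 2 h = - 2 * (\<integral>\<xi>. indicator {0<..} \<xi> * B \<xi> \<partial>lborel)"
    using has_bochner_integral_eq[OF A] AB by simp
  also have "\<bar>\<dots>\<bar> \<le> 2 * (\<integral>\<xi>. \<bar>indicator {0<..} \<xi> * B \<xi>\<bar> \<partial>lborel)"
    using integral_abs_bound[of lborel "\<lambda>\<xi>. indicator {0<..} \<xi> * B \<xi>"] by (simp add: abs_mult)
  also have "\<dots> \<le> 2 * (\<integral>\<xi>. (\<alpha> + \<beta>) / h * (\<bar>\<xi>\<bar> powr (- (\<beta> + 1)) * min 1 (\<bar>\<xi>\<bar> powr \<alpha>)) \<partial>lborel)"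
  proof (intro mult_left_mono integral_mono)
    show "integrable lborel (\<lambda>\<xi>. \<bar>indicator {0<..} \<xi> * B \<xi>\<bar>)"
      using iB by (rule integrable_abs)
    show "integrable lborel (\<lambda>\<xi>. (\<alpha> + \<beta>) / h * (\<bar>\<xi>\<bar> powr (- (\<beta> + 1)) * min 1 (\<bar>\<xi>\<bar> powr \<alpha>)))"
      using \<beta>1 \<beta>\<alpha> by (intro integrable_mult_right integrable_powr_weight[where C=1 and a=\<alpha>]) auto
    fix \<xi> :: real
    have "\<bar>indicator {0<..} \<xi> * B \<xi>\<bar> \<le> \<bar>B \<xi>\<bar>" by (simp add: indicator_def)
    also have "\<dots> \<le> \<bar>\<xi>\<bar> powr (- (\<beta> + 1)) * ((\<alpha> + \<beta>) / h * min 1 (\<bar>\<xi>\<bar> powr \<alpha>))"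
      unfolding B_def abs_mult by (intro mult_mono \<psi>) auto
    finally show "\<bar>indicator {0<..} \<xi> * B \<xi>\<bar> \<le> (\<alpha> + \<beta>) / h * (\<bar>\<xi>\<bar> powr (- (\<beta> + 1)) * min 1 (\<bar>\<xi>\<bar> powr \<alpha>))"
      by (simp only: mult.left_commute)
  qed simp
  also have "\<dots> = decay_const / h"
    by (simp add: decay_const_def)
  finally show ?thesis .
qed

subsection \<open>Gaussian structure and scaling of the solution\<close>

lemma solution_centered_normal:
  assumes "stoch_frac_heat_solution M u \<alpha> H" "0 \<le> fst p"
  shows "centered_normal M (u p) (u_cov \<alpha> H p p)"
  using centered_normal_lincomb[OF assms(1), of 1 "\<lambda>_. p" "\<lambda>_. 1"] assms(2) by simp

text \<open>Differences feed the chaining and the two-point bounds, sums the second moment method;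
  they are the cases a = -1 and a = 1 of one linear combination.\<close>

lemma solution_centered_normal_pair:
  assumes u: "stoch_frac_heat_solution M u \<alpha> H" and pq: "0 \<le> fst p" "0 \<le> fst q"
  shows "centered_normal M (\<lambda>\<omega>. u p \<omega> - u q \<omega>) (incr p q)"
    and "centered_normal M (\<lambda>\<omega>. u p \<omega> + u q \<omega>) (u_cov \<alpha> H p p + u_cov \<alpha> H q q + 2 * u_cov \<alpha> H p q)"
proof -
  have comm: "u_cov \<alpha> H q p = u_cov \<alpha> H p q"
    using u_cov_commute[of "fst p" "fst q" "snd p" "snd q"] pq by simp
  let ?P = "\<lambda>k::nat. if k = 0 then p else q"
  have n: "centered_normal M (\<lambda>\<omega>. u p \<omega> + a * u q \<omega>)
      (u_cov \<alpha> H p p + a * a * u_cov \<alpha> H q q + 2 * a * u_cov \<alpha> H p q)" for a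
    using centered_normal_lincomb[OF u, of 2 ?P "\<lambda>k. if k = 0 then 1 else a"] pq
    by (simp add: numeral_2_eq_2 comm algebra_simps)
  show "centered_normal M (\<lambda>\<omega>. u p \<omega> - u q \<omega>) (incr p q)"
    using n[of "- 1"] by (simp add: incr_def)
  show "centered_normal M (\<lambda>\<omega>. u p \<omega> + u q \<omega>) (u_cov \<alpha> H p p + u_cov \<alpha> H q q + 2 * u_cov \<alpha> H p q)"
    using n[of 1] by simp
qed

definition \<gamma> :: real where "\<gamma> = (\<beta> - 1) / (2 * \<alpha>)"

lemma \<gamma>_pos: "0 < \<gamma>"
  using \<beta>1 \<alpha>1 by (simp add: \<gamma>_def)

lemma \<gamma>_eq: "(2 * H + \<alpha> - 2) / (2 * \<alpha>) = \<gamma>"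
  by (simp add: \<gamma>_def \<beta>_def)

text \<open>The scaling that preserves the equation: one time derivative balances \<alpha> space
  derivatives.\<close>

definition dilate :: "real \<Rightarrow> real \<times> real \<Rightarrow> real \<times> real" where
  "dilate T p = (T * fst p, T powr (1 / \<alpha>) * snd p)"

lemma u_cov_dilate:
  assumes T: "0 < T" and pq: "0 \<le> fst p" "0 \<le> fst q"
  shows "u_cov \<alpha> H (dilate T p) (dilate T q) = (T powr \<gamma>)\<^sup>2 * u_cov \<alpha> H p q"
proof -
  obtain t x t' x' where p: "p = (t, x)" and q: "q = (t', x')" by (cases p; cases q)
  define k where "k = T powr (1 / \<alpha>)"
  have k: "0 < k" "k powr \<alpha> = T" using T \<alpha>1 by (simp_all add: k_def powr_powr)
  have t: "0 \<le> t" "0 \<le> t'" using pq by (simp_all add: p q)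
  have "1 / \<alpha> * (\<beta> - 1) = \<gamma> + \<gamma>" using \<alpha>1 by (simp add: \<gamma>_def field_simps)
  then have kT: "k powr (\<beta> - 1) = (T powr \<gamma>)\<^sup>2"
    unfolding k_def powr_powr by (simp only: powr_add power2_eq_square)
  have "u_cov \<alpha> H (dilate T p) (dilate T q)
      = c1H H * heat_int \<bar>T * t - T * t'\<bar> (T * t + T * t') (k * x - k * x')"
    using t T by (simp add: dilate_def p q k_def u_cov_eq)
  also have "\<bar>T * t - T * t'\<bar> = k powr \<alpha> * \<bar>t - t'\<bar>"
    using T by (simp add: k abs_mult flip: right_diff_distrib)
  also have "T * t + T * t' = k powr \<alpha> * (t + t')" by (simp add: k distrib_left)
  also have "k * x - k * x' = k * (x - x')" by (simp add: right_diff_distrib)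
  also have "heat_int (k powr \<alpha> * \<bar>t - t'\<bar>) (k powr \<alpha> * (t + t')) (k * (x - x'))
      = (T powr \<gamma>)\<^sup>2 * heat_int \<bar>t - t'\<bar> (t + t') (x - x')"
    unfolding kT[symmetric] by (rule heat_int_scale[OF k(1)])
  finally show ?thesis
    using t by (simp add: p q u_cov_eq)
qed

text \<open>Being a solution is a matter of finite-dimensional laws, and the covariance scales by
  T^(2\<gamma>). Bounds proved at unit scale for every solution therefore apply directly to the
  rescaled field.\<close>

lemma solution_dilate:
  assumes u: "stoch_frac_heat_solution M u \<alpha> H" and T: "0 < T"
  shows "stoch_frac_heat_solution M (\<lambda>p \<omega>. T powr (- \<gamma>) * u (dilate T p) \<omega>) \<alpha> H"
  unfolding stoch_frac_heat_solution_def
proof (intro conjI allI impI)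
  show "prob_space M" using u by (rule stoch_frac_heat_solution_prob_space)
  have pos: "0 \<le> fst (dilate T p)" if "0 \<le> fst p" for p using that T by (simp add: dilate_def)
  show "(\<lambda>\<omega>. T powr (- \<gamma>) * u (dilate T p) \<omega>) \<in> borel_measurable M" if "0 \<le> fst p" for p
  proof -
    have "u (dilate T p) \<in> borel_measurable M"
      using u pos[OF that] unfolding stoch_frac_heat_solution_def by blast
    then show ?thesis by simp
  qed
  fix n :: nat and P :: "nat \<Rightarrow> real \<times> real" and a :: "nat \<Rightarrow> real" and \<theta> :: real
  assume P: "\<forall>k<n. 0 \<le> fst (P k)"
  have inv: "T powr (- \<gamma>) * T powr \<gamma> = 1"
    using T by (simp flip: powr_add)
  have cov: "(a j * T powr (- \<gamma>)) * (a k * T powr (- \<gamma>)) * u_cov \<alpha> H (dilate T (P j)) (dilate T (P k))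
      = a j * a k * u_cov \<alpha> H (P j) (P k)" if "j < n" "k < n" for j k
  proof -
    have "(a j * T powr (- \<gamma>)) * (a k * T powr (- \<gamma>)) * u_cov \<alpha> H (dilate T (P j)) (dilate T (P k))
        = (T powr (- \<gamma>) * T powr \<gamma>)\<^sup>2 * (a j * a k * u_cov \<alpha> H (P j) (P k))"
      using that P by (subst u_cov_dilate[OF T]) (simp_all add: power2_eq_square)
    then show ?thesis by (simp add: inv)
  qed
  have "(\<integral>\<omega>. cis (\<theta> * (\<Sum>k<n. (a k * T powr (- \<gamma>)) * u (dilate T (P k)) \<omega>)) \<partial>M) =
      complex_of_real (exp (- (\<theta>\<^sup>2 / 2) * (\<Sum>j<n. \<Sum>k<n. (a j * T powr (- \<gamma>)) * (a k * T powr (- \<gamma>)) *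
        u_cov \<alpha> H (dilate T (P j)) (dilate T (P k)))))"
    by (rule stoch_frac_heat_solution_cis[OF u]) (use P pos in simp)
  also have "(\<Sum>j<n. \<Sum>k<n. (a j * T powr (- \<gamma>)) * (a k * T powr (- \<gamma>)) * u_cov \<alpha> H (dilate T (P j)) (dilate T (P k)))
      = (\<Sum>j<n. \<Sum>k<n. a j * a k * u_cov \<alpha> H (P j) (P k))"
    by (intro sum.cong refl cov) auto
  finally show "(\<integral>\<omega>. cis (\<theta> * (\<Sum>k<n. a k * (T powr (- \<gamma>) * u (dilate T (P k)) \<omega>))) \<partial>M) =
      complex_of_real (exp (- (\<theta>\<^sup>2 / 2) * (\<Sum>j<n. \<Sum>k<n. a j * a k * u_cov \<alpha> H (P j) (P k))))"
    by (simp only: mult.assoc)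
qed

subsection \<open>Chaining along dyadic grids\<close>

text \<open>Rounding down keeps times in [0,1]. The same mesh serves both coordinates although the
  field is smoother in space than in time; the excess of spatial points changes only
  constants.\<close>

definition dyadic :: "nat \<Rightarrow> real \<times> real \<Rightarrow> real \<times> real" where
  "dyadic n p = (of_int \<lfloor>2 ^ n * fst p\<rfloor> / 2 ^ n, of_int \<lfloor>2 ^ n * snd p\<rfloor> / 2 ^ n)"

text \<open>The grids are nested. Hence a link between levels n and n + 1 is determined by the finer
  grid point alone, and a maximum over links runs over grid points, however many points the index
  set has.\<close>

lemma dyadic_dyadic_Suc: "dyadic n (dyadic (Suc n) p) = dyadic n p"
proof -
  have "\<lfloor>2 ^ n * (real_of_int \<lfloor>2 ^ Suc n * x\<rfloor> / 2 ^ Suc n)\<rfloor> = \<lfloor>2 ^ n * x\<rfloor>" for x :: real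
  proof -
    have "2 ^ n * (of_int \<lfloor>2 ^ Suc n * x\<rfloor> / 2 ^ Suc n) = of_int \<lfloor>2 ^ Suc n * x\<rfloor> / (2::real)"
      by simp
    moreover have "\<lfloor>real_of_int \<lfloor>2 ^ Suc n * x\<rfloor> / 2\<rfloor> = \<lfloor>2 ^ n * x\<rfloor>"
      using floor_divide_of_int_eq[of "\<lfloor>2 ^ Suc n * x\<rfloor>" 2, where ?'a = real]
        floor_divide_real_eq_div[of 2 "2 ^ Suc n * x"] by simp
    ultimately show ?thesis by simp
  qed
  then show ?thesis by (simp add: dyadic_def)
qed

lemma dyadic_dist: "\<bar>fst p - fst (dyadic n p)\<bar> \<le> (1 / 2) ^ n" "\<bar>snd p - snd (dyadic n p)\<bar> \<le> (1 / 2) ^ n"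
proof -
  have "\<bar>x - of_int \<lfloor>2 ^ n * x\<rfloor> / 2 ^ n\<bar> \<le> (1 / 2) ^ n" for x :: real
  proof -
    have "x - of_int \<lfloor>2 ^ n * x\<rfloor> / 2 ^ n = (2 ^ n * x - of_int \<lfloor>2 ^ n * x\<rfloor>) / 2 ^ n"
      by (simp add: diff_divide_distrib)
    moreover have "\<bar>2 ^ n * x - of_int \<lfloor>2 ^ n * x\<rfloor>\<bar> \<le> 1" by linarith
    ultimately show ?thesis
      by (simp add: abs_divide power_one_over divide_right_mono inverse_eq_divide)
  qed
  then show "\<bar>fst p - fst (dyadic n p)\<bar> \<le> (1 / 2) ^ n" "\<bar>snd p - snd (dyadic n p)\<bar> \<le> (1 / 2) ^ n"
    by (simp_all add: dyadic_def)
qed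

lemma dyadic_fst_nonneg: "0 \<le> fst p \<Longrightarrow> 0 \<le> fst (dyadic n p)"
  by (simp add: dyadic_def)

lemma dyadic_fst_le_1: "fst p \<le> 1 \<Longrightarrow> fst (dyadic n p) \<le> 1"
proof -
  assume "fst p \<le> 1"
  then have "2 ^ n * fst p \<le> (2 ^ n :: real)" by simp
  moreover have "of_int \<lfloor>2 ^ n * fst p\<rfloor> \<le> 2 ^ n * fst p" by linarith
  ultimately have "of_int \<lfloor>2 ^ n * fst p\<rfloor> / 2 ^ n \<le> (1::real)"
    by (subst pos_divide_le_eq) (simp, linarith)
  then show ?thesis by (simp add: dyadic_def)
qed

text \<open>There are at most 2^n + 1 times and 2^n * 2L + 2 positions. Absorbing the additive
  constants keeps the bound valid for small L.\<close>

lemma card_dyadic_image: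
  assumes F: "F \<subseteq> {0..1} \<times> {-L..L}" and L: "0 < L"
  shows "real (card (dyadic n ` F)) \<le> 4 ^ n * (4 * L + 4)"
proof -
  define I where "I = {0..(2 ^ n :: int)}"
  define J where "J = {\<lfloor>- (2 ^ n * L)\<rfloor>..\<lfloor>2 ^ n * L\<rfloor>}"
  have "dyadic n ` F \<subseteq> (\<lambda>(i, j). (of_int i / 2 ^ n, of_int j / 2 ^ n)) ` (I \<times> J)"
  proof
    fix y assume "y \<in> dyadic n ` F"
    then obtain p where p: "p \<in> F" "y = dyadic n p" by auto
    with F have fp: "0 \<le> fst p" "fst p \<le> 1" "- L \<le> snd p" "snd p \<le> L" by auto
    have "2 ^ n * fst p \<le> 2 ^ n * 1" by (intro mult_left_mono fp) simp
    then have "\<lfloor>2 ^ n * fst p\<rfloor> \<le> \<lfloor>2 ^ n :: real\<rfloor>" by (intro floor_mono) simp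
    also have "\<lfloor>2 ^ n :: real\<rfloor> = 2 ^ n" using floor_of_int[of "2 ^ n", where ?'a = real] by simp
    finally have "\<lfloor>2 ^ n * fst p\<rfloor> \<in> I" using fp by (simp add: I_def)
    moreover have "2 ^ n * snd p \<le> 2 ^ n * L" "2 ^ n * (- L) \<le> 2 ^ n * snd p"
      by (intro mult_left_mono fp; simp)+
    then have "\<lfloor>2 ^ n * snd p\<rfloor> \<in> J" unfolding J_def by (auto intro!: floor_mono)
    ultimately show "y \<in> (\<lambda>(i, j). (of_int i / 2 ^ n, of_int j / 2 ^ n)) ` (I \<times> J)"
      by (auto simp: p(2) dyadic_def)
  qed
  then have "card (dyadic n ` F) \<le> card (I \<times> J)"
    by (rule surj_card_le[rotated]) (simp add: I_def J_def)
  also have "\<dots> = card I * card J" by (rule card_cartesian_product)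
  finally have "real (card (dyadic n ` F)) \<le> real (card I) * real (card J)"
    by (simp flip: of_nat_mult)
  also have "\<dots> \<le> (2 * 2 ^ n) * (2 ^ n * (2 * L + 2))"
  proof (intro mult_mono)
    have "real (card I) = 2 ^ n + 1" by (simp add: I_def)
    also have "\<dots> \<le> 2 * 2 ^ n" by simp
    finally show "real (card I) \<le> 2 * 2 ^ n" .
    have "\<lfloor>- (2 ^ n * L)\<rfloor> \<le> \<lfloor>2 ^ n * L\<rfloor>" using L by (intro floor_mono) (simp add: order_trans[of _ 0])
    then have "real (card J) = of_int \<lfloor>2 ^ n * L\<rfloor> - of_int \<lfloor>- (2 ^ n * L)\<rfloor> + 1"
      by (simp add: J_def)
    also have "\<dots> \<le> 2 ^ n * L + 2 ^ n * L + 2" by linarith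
    also have "\<dots> \<le> 2 ^ n * (2 * L + 2)" by (simp add: distrib_left)
    finally show "real (card J) \<le> 2 ^ n * (2 * L + 2)" .
  qed auto
  also have "\<dots> = 4 ^ n * (4 * L + 4)"
    by (simp add: power_mult_distrib[symmetric] algebra_simps flip: power_mult_distrib)
  finally show ?thesis .
qed

text \<open>The 2 accounts for the two coordinates of an increment; the 1 makes the scale strictly
  positive, as \<open>expectation_Max_le\<close> requires of \<open>d\<close>.\<close>

definition mod_const :: real where "mod_const = sqrt (2 * incr_const) + 1"

definition ratio :: real where "ratio = (1 / 2) powr \<gamma>"

lemma mod_const_pos: "0 < mod_const"
  using incr_const_nonneg by (simp add: mod_const_def add_nonneg_pos)

lemma ratio: "0 < ratio" "ratio < 1"
  using \<gamma>_pos powr_less_mono2[of \<gamma> "1 / 2" 1] by (simp_all add: ratio_def)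

lemma incr_const_le: "2 * incr_const \<le> mod_const\<^sup>2"
proof -
  have "2 * incr_const = (sqrt (2 * incr_const))\<^sup>2" using incr_const_nonneg by simp
  also have "\<dots> \<le> mod_const\<^sup>2"
    unfolding mod_const_def using incr_const_nonneg by (intro power_mono) auto
  finally show ?thesis .
qed

text \<open>Both coordinates move by at most 2^(-n) \<le> 1, so the smaller exponent, that of time,
  dominates; it equals 2\<gamma>, and \<open>ratio\<close> is the factor by which the standard
  deviation drops per level.\<close>

lemma incr_dyadic_le:
  assumes p: "0 \<le> fst p"
  shows "incr p (dyadic n p) \<le> (mod_const * ratio ^ n)\<^sup>2"
proof -
  let ?\<delta> = "(1 / 2) ^ n :: real"
  have e: "(\<beta> - 1) / \<alpha> = \<gamma> + \<gamma>" "(\<beta> - 1) / \<alpha> \<le> \<beta> - 1"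
    using \<alpha>1 \<beta>1 divide_left_mono[of 1 \<alpha> "\<beta> - 1"] by (simp_all add: \<gamma>_def field_simps)
  have \<delta>: "0 < ?\<delta>" "?\<delta> \<le> 1" by (simp_all add: power_le_one)
  have "\<bar>fst p - fst (dyadic n p)\<bar> powr ((\<beta> - 1) / \<alpha>) \<le> ?\<delta> powr ((\<beta> - 1) / \<alpha>)"
    using \<alpha>1 \<beta>1 by (intro powr_mono2 dyadic_dist) auto
  moreover have "\<bar>snd p - snd (dyadic n p)\<bar> powr (\<beta> - 1) \<le> ?\<delta> powr (\<beta> - 1)"
    using \<beta>1 by (intro powr_mono2 dyadic_dist) auto
  moreover have "?\<delta> powr (\<beta> - 1) \<le> ?\<delta> powr ((\<beta> - 1) / \<alpha>)"
    using e \<delta> by (intro powr_mono') auto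
  ultimately have sum: "\<bar>fst p - fst (dyadic n p)\<bar> powr ((\<beta> - 1) / \<alpha>) + \<bar>snd p - snd (dyadic n p)\<bar> powr (\<beta> - 1)
      \<le> 2 * ?\<delta> powr ((\<beta> - 1) / \<alpha>)" by linarith
  have "incr p (dyadic n p) \<le> incr_const * (2 * ?\<delta> powr ((\<beta> - 1) / \<alpha>))"
    using incr_le[of "fst p" "fst (dyadic n p)" "snd p" "snd (dyadic n p)"] dyadic_fst_nonneg[OF p] p
      mult_left_mono[OF sum incr_const_nonneg] by simp
  also have "?\<delta> powr ((\<beta> - 1) / \<alpha>) = (ratio ^ n)\<^sup>2"
  proof -
    have "?\<delta> powr \<gamma> = ratio ^ n"
      unfolding ratio_def by (simp add: powr_power powr_powr mult.commute flip: powr_realpow)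
    then show ?thesis unfolding e(1) by (simp only: powr_add power2_eq_square)
  qed
  also have "incr_const * (2 * (ratio ^ n)\<^sup>2) = 2 * incr_const * (ratio ^ n)\<^sup>2" by simp
  also have "\<dots> \<le> mod_const\<^sup>2 * (ratio ^ n)\<^sup>2"
    by (intro mult_right_mono incr_const_le) simp
  finally show ?thesis by (simp add: power_mult_distrib)
qed

text \<open>The field vanishes at time 0, so its variance is that of the increment down to
  (0,x).\<close>

lemma u_cov_le_mod_const:
  assumes p: "0 \<le> fst p" "fst p \<le> 1"
  shows "u_cov \<alpha> H p p \<le> mod_const\<^sup>2"
proof -
  obtain t x where p_eq: "p = (t, x)" by (cases p)
  have t: "0 \<le> t" "t \<le> 1" using p by (simp_all add: p_eq)
  have "u_cov \<alpha> H p p = incr (t, x) (0, x)"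
    using t by (simp add: p_eq incr_def u_cov_eq heat_int_def)
  also have "\<dots> \<le> incr_const * (t powr ((\<beta> - 1) / \<alpha>) + 0)"
    using incr_le[of t 0 x x] t by simp
  also have "\<dots> \<le> incr_const * (1 + 0)"
    using t \<alpha>1 \<beta>1 incr_const_nonneg by (intro mult_left_mono add_mono powr_le1) auto
  also have "\<dots> = incr_const" by simp
  also have "\<dots> \<le> mod_const\<^sup>2" using incr_const_le incr_const_nonneg by linarith
  finally show ?thesis .
qed

text \<open>The summand 2 comes from the coarsest grid, the k-th term of the series from the link
  between levels k and k + 1; 2k + 4 is 2(k + 1) + 2 from \<open>sqrt_ln_grid_le\<close>.\<close>

definition chain_const :: real where
  "chain_const = mod_const * (2 + (\<Sum>k. ratio ^ k * (2 * real k + 4)))"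

lemma summable_chain: "summable (\<lambda>k. ratio ^ k * (2 * real k + 4))"
proof -
  have "summable (\<lambda>k. 2 * (of_nat (Suc k) * ratio ^ k) + 2 * ratio ^ k)"
    using ratio geometric_deriv_sums[of ratio]
    by (intro summable_add summable_mult summable_geometric) (auto simp: sums_iff)
  then show ?thesis by (simp add: algebra_simps)
qed

text \<open>This separates the level from L, so that the chaining sum factors. With m = 4L + 4 one
  has ln m \<ge> 1 and ln 4 \<le> 2, hence 2 ln(4^k m) \<le> (4k + 2) ln m \<le> (2k + 2)^2 ln
  m.\<close>

lemma sqrt_ln_grid_le:
  assumes "0 < L"
  shows "sqrt (2 * ln (4 ^ k * (4 * L + 4))) \<le> (2 * real k + 2) * sqrt (ln (4 * L + 4))"
proof -
  have ln4: "ln 4 \<le> (2::real)" "1 \<le> ln (4::real)"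
  proof -
    have "ln (4::real) = 2 * ln 2" using ln_realpow[of 2 2] by simp
    then show "ln 4 \<le> (2::real)" "1 \<le> ln (4::real)" using ln_2_less_1 ln2_ge_two_thirds by auto
  qed
  have "ln 4 \<le> ln (4 * L + 4)" using assms by simp
  with ln4 have m: "1 \<le> ln (4 * L + 4)" by linarith
  have "ln (4 ^ k * (4 * L + 4)) = ln (4 ^ k) + ln (4 * L + 4)"
    using assms by (intro ln_mult_pos) auto
  then have "2 * ln (4 ^ k * (4 * L + 4)) = 2 * real k * ln 4 + 2 * ln (4 * L + 4)"
    by (simp add: ln_realpow)
  also have "\<dots> \<le> 2 * real k * 2 + 2 * ln (4 * L + 4)"
    using ln4 by (intro add_right_mono mult_left_mono) auto
  also have "\<dots> \<le> (4 * real k) * ln (4 * L + 4) + 2 * ln (4 * L + 4)"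
  proof -
    have "4 * real k * 1 \<le> 4 * real k * ln (4 * L + 4)" using m by (intro mult_left_mono) auto
    then show ?thesis by simp
  qed
  also have "\<dots> = (4 * real k + 2) * ln (4 * L + 4)" by (simp add: algebra_simps)
  also have "\<dots> \<le> (2 * real k + 2)\<^sup>2 * ln (4 * L + 4)"
    using m by (intro mult_right_mono) (auto simp: power2_eq_square algebra_simps)
  finally have "sqrt (2 * ln (4 ^ k * (4 * L + 4))) \<le> sqrt ((2 * real k + 2)\<^sup>2 * ln (4 * L + 4))"
    by (rule real_sqrt_le_mono)
  then show ?thesis by (simp add: real_sqrt_mult)
qed

text \<open>4L + 4 is at most 8 max(L,1); the summand 1 in \<open>Psi\<close> absorbs the additive
  ln 8.\<close>

lemma sqrt_ln_le_Psi:
  assumes "0 < L"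
  shows "sqrt (ln (4 * L + 4)) \<le> 2 * Psi \<alpha> 1 L"
proof -
  define l where "l = log 2 (max L 1)"
  have l: "0 \<le> l" by (simp add: l_def zero_le_log_cancel_iff)
  have ln2: "0 < ln (2::real)" "ln (2::real) \<le> 1" using ln_2_less_1 by auto
  have "ln (4 * L + 4) \<le> ln (2 ^ 3 * max L 1)" using assms by (intro ln_mono) (auto simp: max_def)
  also have "\<dots> = ln (2 ^ 3) + ln (max L 1)" by (intro ln_mult_pos) auto
  also have "\<dots> = 3 * ln 2 + ln 2 * l"
    using ln_realpow[of "2::real" 3] by (simp add: l_def log_def)
  also have "\<dots> \<le> 3 * 1 + 1 * l" using ln2 l by (intro add_mono mult_mono) auto
  also have "\<dots> \<le> (2 * (1 + sqrt l))\<^sup>2"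
  proof -
    have "(2 * (1 + sqrt l))\<^sup>2 = 4 + 8 * sqrt l + 4 * l"
      using l by (simp add: power2_eq_square algebra_simps)
    then show ?thesis using l real_sqrt_ge_zero[OF l] by linarith
  qed
  finally have "sqrt (ln (4 * L + 4)) \<le> 2 * (1 + sqrt l)"
    using l by (intro real_le_lsqrt) auto
  then show ?thesis by (simp add: Psi_def l_def)
qed

text \<open>Chaining up to level n costs a partial sum of a convergent series, whatever n is. The
  remaining distance from the grid to the fixed finite set \<open>F\<close> disappears as n grows,
  so the bound is uniform in \<open>F\<close>.\<close>

lemma unit_upper_bound:
  assumes u: "stoch_frac_heat_solution M u \<alpha> H" and L: "0 < L"
    and F: "finite F" "F \<noteq> {}" "F \<subseteq> {0..1} \<times> {-L..L}"
  shows "(\<integral>\<omega>. Max ((\<lambda>p. u p \<omega>) ` F) \<partial>M) \<le> 2 * chain_const * Psi \<alpha> 1 L"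
proof -
  interpret prob_space M using u by (rule stoch_frac_heat_solution_prob_space)
  define \<pi> where "\<pi> = dyadic"
  define s where "s = sqrt (ln (4 * L + 4))"
  have s: "0 \<le> s" using L by (simp add: s_def)
  define E where "E g = (\<integral>\<omega>. Max ((\<lambda>p. g p \<omega>) ` F) \<partial>M)" for g :: "real \<times> real \<Rightarrow> 'a \<Rightarrow> real"
  have F_nonneg: "0 \<le> fst p" "fst p \<le> 1" if "p \<in> F" for p using F that by auto
  have int: "integrable M (u p)" if "0 \<le> fst p" for p
    by (rule centered_normal_integrable[OF solution_centered_normal[OF u that]])
  \<comment> \<open>Subadditivity of the expected maximum, which lets the chain be estimated link by
    link.\<close>
  have E_add: "E (\<lambda>p \<omega>. f p \<omega> + g p \<omega>) \<le> E f + E g"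
    if "\<And>p. p \<in> F \<Longrightarrow> integrable M (f p)" "\<And>p. p \<in> F \<Longrightarrow> integrable M (g p)" for f g
  proof -
    have "E (\<lambda>p \<omega>. f p \<omega> + g p \<omega>) \<le> (\<integral>\<omega>. Max ((\<lambda>p. f p \<omega>) ` F) + Max ((\<lambda>p. g p \<omega>) ` F) \<partial>M)"
      unfolding E_def
    proof (rule integral_mono)
      show "integrable M (\<lambda>\<omega>. Max ((\<lambda>p. f p \<omega> + g p \<omega>) ` F))"
        using F that by (intro integrable_MAX) auto
      show "integrable M (\<lambda>\<omega>. Max ((\<lambda>p. f p \<omega>) ` F) + Max ((\<lambda>p. g p \<omega>) ` F))"
        using F that by (intro Bochner_Integration.integrable_add integrable_MAX) auto
      fix \<omega>
      show "Max ((\<lambda>p. f p \<omega> + g p \<omega>) ` F) \<le> Max ((\<lambda>p. f p \<omega>) ` F) + Max ((\<lambda>p. g p \<omega>) ` F)"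
        using F by (auto intro!: add_mono Max_ge)
    qed
    also have "\<dots> = E f + E g"
      unfolding E_def using F that by (intro Bochner_Integration.integral_add integrable_MAX) auto
    finally show ?thesis .
  qed
  have level: "E (\<lambda>p. u (\<pi> n p)) \<le> mod_const * s * (2 + (\<Sum>k<n. ratio ^ k * (2 * real k + 4)))" for n
  proof (induction n)
    case 0
    have "E (\<lambda>p. u (\<pi> 0 p)) = (\<integral>\<omega>. Max ((\<lambda>q. u q \<omega>) ` (\<pi> 0 ` F)) \<partial>M)"
      by (simp add: E_def image_image)
    also have "\<dots> \<le> mod_const * sqrt (2 * ln (4 ^ 0 * (4 * L + 4)))"
    proof (rule expectation_Max_le)
      show "real (card (\<pi> 0 ` F)) \<le> 4 ^ 0 * (4 * L + 4)"
        unfolding \<pi>_def using F(3) L by (rule card_dyadic_image)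
      fix q assume "q \<in> \<pi> 0 ` F"
      then obtain p where "p \<in> F" "q = \<pi> 0 p" by blast
      then have q: "0 \<le> fst q" "fst q \<le> 1"
        unfolding \<pi>_def by (simp_all only: F_nonneg dyadic_fst_nonneg dyadic_fst_le_1)
      show "centered_normal M (u q) (u_cov \<alpha> H q q)" using u q by (rule_tac solution_centered_normal)
      show "u_cov \<alpha> H q q \<le> mod_const\<^sup>2" by (rule u_cov_le_mod_const[OF q])
    qed (use F L mod_const_pos in auto)
    also have "\<dots> \<le> mod_const * ((2 * real 0 + 2) * s)"
      unfolding s_def using mod_const_pos L by (intro mult_left_mono sqrt_ln_grid_le) auto
    finally show ?case by (simp add: mult_ac)
  next
    case (Suc n)
    define D where "D q \<omega> = u q \<omega> - u (\<pi> n q) \<omega>" for q \<omega>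
    have "E (\<lambda>p. u (\<pi> (Suc n) p)) = E (\<lambda>p \<omega>. u (\<pi> n p) \<omega> + D (\<pi> (Suc n) p) \<omega>)"
      by (simp add: D_def \<pi>_def dyadic_dyadic_Suc)
    also have "\<dots> \<le> E (\<lambda>p. u (\<pi> n p)) + E (\<lambda>p. D (\<pi> (Suc n) p))"
      unfolding D_def \<pi>_def
      by (intro E_add Bochner_Integration.integrable_diff int dyadic_fst_nonneg F_nonneg)
    also have "E (\<lambda>p. D (\<pi> (Suc n) p)) = (\<integral>\<omega>. Max ((\<lambda>q. D q \<omega>) ` (\<pi> (Suc n) ` F)) \<partial>M)"
      by (simp add: E_def image_image)
    also have "\<dots> \<le> (mod_const * ratio ^ n) * sqrt (2 * ln (4 ^ Suc n * (4 * L + 4)))"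
    proof (rule expectation_Max_le)
      show "real (card (\<pi> (Suc n) ` F)) \<le> 4 ^ Suc n * (4 * L + 4)"
        unfolding \<pi>_def using F(3) L by (rule card_dyadic_image)
      have "2 \<le> 1 * (4 * L + 4)" using L by simp
      also have "\<dots> \<le> 4 ^ Suc n * (4 * L + 4)" using L by (intro mult_right_mono one_le_power) auto
      finally show "2 \<le> 4 ^ Suc n * (4 * L + 4)" .
      fix q assume "q \<in> \<pi> (Suc n) ` F"
      then obtain p where "p \<in> F" "q = \<pi> (Suc n) p" by blast
      then have q: "0 \<le> fst q"
        unfolding \<pi>_def by (simp only: F_nonneg dyadic_fst_nonneg)
      show "centered_normal M (D q) (incr q (\<pi> n q))"
        unfolding D_def \<pi>_def using u q by (intro solution_centered_normal_pair dyadic_fst_nonneg)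
      show "incr q (\<pi> n q) \<le> (mod_const * ratio ^ n)\<^sup>2"
        unfolding \<pi>_def using q by (rule incr_dyadic_le)
    qed (use F mod_const_pos ratio in auto)
    also have "\<dots> \<le> (mod_const * ratio ^ n) * ((2 * real (Suc n) + 2) * s)"
      unfolding s_def using mod_const_pos ratio L by (intro mult_left_mono sqrt_ln_grid_le) auto
    finally show ?case using Suc by (simp add: algebra_simps)
  qed
  \<comment> \<open>The last link is bounded crudely with the cardinality of \<open>F\<close>; the
    factor \<open>ratio ^ n\<close> removes it in the limit. The 2 satisfies the lower bound on
    \<open>m\<close> in \<open>expectation_Max_le\<close>.\<close>
  define m where "m = max 2 (real (card F))"
  define S where "S = (\<Sum>k. ratio ^ k * (2 * real k + 4))"
  have bound: "E u \<le> mod_const * s * (2 + S) + mod_const * ratio ^ n * sqrt (2 * ln m)" for n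
  proof -
    have "E u = E (\<lambda>p \<omega>. u (\<pi> n p) \<omega> + (u p \<omega> - u (\<pi> n p) \<omega>))" by simp
    also have "\<dots> \<le> E (\<lambda>p. u (\<pi> n p)) + E (\<lambda>p \<omega>. u p \<omega> - u (\<pi> n p) \<omega>)"
      unfolding \<pi>_def by (intro E_add Bochner_Integration.integrable_diff int dyadic_fst_nonneg F_nonneg)
    also have "E (\<lambda>p. u (\<pi> n p)) \<le> mod_const * s * (2 + S)"
    proof -
      have "(\<Sum>k<n. ratio ^ k * (2 * real k + 4)) \<le> S"
        unfolding S_def using ratio by (intro sum_le_suminf summable_chain) auto
      then have "mod_const * s * (2 + (\<Sum>k<n. ratio ^ k * (2 * real k + 4))) \<le> mod_const * s * (2 + S)"
        using mod_const_pos s by (intro mult_left_mono) auto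
      with level[of n] show ?thesis by linarith
    qed
    also have "E (\<lambda>p \<omega>. u p \<omega> - u (\<pi> n p) \<omega>) \<le> mod_const * ratio ^ n * sqrt (2 * ln m)"
      unfolding E_def
    proof (rule expectation_Max_le)
      fix p assume "p \<in> F"
      then have p: "0 \<le> fst p" by (rule F_nonneg)
      show "centered_normal M (\<lambda>\<omega>. u p \<omega> - u (\<pi> n p) \<omega>) (incr p (\<pi> n p))"
        unfolding \<pi>_def using u p by (intro solution_centered_normal_pair dyadic_fst_nonneg)
      show "incr p (\<pi> n p) \<le> (mod_const * ratio ^ n)\<^sup>2"
        unfolding \<pi>_def using p by (rule incr_dyadic_le)
    qed (use F mod_const_pos ratio in \<open>auto simp: m_def\<close>)
    finally show ?thesis by simp
  qed
  have "(\<lambda>n. mod_const * s * (2 + S) + mod_const * ratio ^ n * sqrt (2 * ln m))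
      \<longlonglongrightarrow> mod_const * s * (2 + S) + mod_const * 0 * sqrt (2 * ln m)"
    using ratio by (intro tendsto_intros LIMSEQ_power_zero) auto
  then have "E u \<le> mod_const * s * (2 + S) + mod_const * 0 * sqrt (2 * ln m)"
    by (rule LIMSEQ_le_const) (use bound in blast)
  also have "\<dots> = chain_const * s" by (simp add: chain_const_def S_def mult_ac)
  also have "\<dots> \<le> chain_const * (2 * Psi \<alpha> 1 L)"
  proof (rule mult_left_mono)
    show "s \<le> 2 * Psi \<alpha> 1 L" unfolding s_def using L by (rule sqrt_ln_le_Psi)
    show "0 \<le> chain_const"
      unfolding chain_const_def using mod_const_pos ratio
      by (intro mult_nonneg_nonneg add_nonneg_nonneg suminf_nonneg summable_chain) auto
  qed
  finally show ?thesis by (simp add: E_def mult_ac)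
qed

subsection \<open>Lower bounds\<close>

definition unit_var :: real where "unit_var = c1H H * heat_int 0 2 0"

lemma unit_var_pos: "0 < unit_var"
  using heat_int_0_2_pos gap_const_pos c1H_pos by (simp add: unit_var_def)

lemma u_cov_time_1: "u_cov \<alpha> H (1, x) (1, y) = c1H H * heat_int 0 2 \<bar>x - y\<bar>"
proof -
  have "cos (\<bar>h\<bar> * \<xi>) = cos (h * \<xi>)" for h \<xi> :: real by (auto simp: abs_if)
  then have "heat_int 0 2 (x - y) = heat_int 0 2 \<bar>x - y\<bar>" by (simp add: heat_int_def)
  then show ?thesis by (simp add: u_cov_eq)
qed

lemma expectation_Max_pair:
  assumes u: "stoch_frac_heat_solution M u \<alpha> H" and pq: "0 \<le> fst p" "0 \<le> fst q"
  shows "(\<integral>\<omega>. Max ((\<lambda>p. u p \<omega>) ` {p, q}) \<partial>M) = sqrt (incr p q) / sqrt (2 * pi)"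
proof -
  interpret prob_space M using u by (rule stoch_frac_heat_solution_prob_space)
  show ?thesis
    using expectation_max_two[OF solution_centered_normal[OF u pq(1)] solution_centered_normal[OF u pq(2)]
        solution_centered_normal_pair(1)[OF u pq]] by simp
qed

text \<open>The field vanishes at (0,0), so the increment has the full variance at time 1. This
  gives a positive bound however short the spatial interval is.\<close>

lemma expectation_Max_origin:
  assumes u: "stoch_frac_heat_solution M u \<alpha> H"
  shows "(\<integral>\<omega>. Max ((\<lambda>p. u p \<omega>) ` {(1, 0), (0, 0)}) \<partial>M) = sqrt unit_var / sqrt (2 * pi)"
proof -
  have "incr (1, 0) (0, 0) = unit_var"
    by (simp add: incr_def u_cov_eq heat_int_def unit_var_def)
  then show ?thesis using expectation_Max_pair[OF u, of "(1, 0)" "(0, 0)"] by simp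
qed

text \<open>The two points are 2L \<ge> 2 apart, where the spectral gap bounds the variance of the
  difference independently of L.\<close>

lemma two_point_lower_bound:
  assumes u: "stoch_frac_heat_solution M u \<alpha> H" and L: "1 \<le> L"
  shows "sqrt (2 * c1H H * gap_const) / sqrt (2 * pi) \<le> (\<integral>\<omega>. Max ((\<lambda>p. u p \<omega>) ` {(1, - L), (1, L)}) \<partial>M)"
proof -
  have "incr (1, - L) (1, L) = 2 * c1H H * (heat_int 0 2 0 - heat_int 0 2 (2 * L))"
    using L by (simp add: incr_def u_cov_time_1 algebra_simps)
  also have "\<dots> \<ge> 2 * c1H H * gap_const"
    using heat_int_gap[of "2 * L"] L c1H_pos by (intro mult_left_mono) auto
  finally have "sqrt (2 * c1H H * gap_const) \<le> sqrt (incr (1, - L) (1, L))" by simp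
  then have "sqrt (2 * c1H H * gap_const) / sqrt (2 * pi) \<le> sqrt (incr (1, - L) (1, L)) / sqrt (2 * pi)"
    by (rule divide_right_mono) simp
  then show ?thesis using expectation_Max_pair[OF u, of "(1, - L)" "(1, L)"] by simp
qed

text \<open>Points at spacing L/N have covariance at most a constant times N/L. With the crude ln N
  \<le> N the decorrelation hypothesis becomes N^2 \<le> const L; this is why sqrt L points are
  taken, and ln N still has the order of ln L.\<close>

lemma grid_lower_bound:
  assumes u: "stoch_frac_heat_solution M u \<alpha> H" and L: "0 < L"
    and N: "exp 4 \<le> real N" "c1H H * decay_const * (real N)\<^sup>2 \<le> unit_var * L"
  defines "P \<equiv> \<lambda>i. (1, real i * L / real N)"
  shows "sqrt unit_var * (sqrt (ln (real N)) / 64 - 1) \<le> (\<integral>\<omega>. Max ((\<lambda>p. u p \<omega>) ` (P ` {..<N})) \<partial>M)"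
proof -
  interpret prob_space M using u by (rule stoch_frac_heat_solution_prob_space)
  have N0: "0 < real N" using N(1) exp_gt_zero[of "4::real"] by linarith
  have var: "u_cov \<alpha> H (P i) (P i) = unit_var" for i
    by (simp add: P_def u_cov_time_1 unit_var_def)
  have "sqrt unit_var * (sqrt (ln (card {..<N})) / 64 - 1) \<le> (\<integral>\<omega>. Max ((\<lambda>i. u (P i) \<omega>) ` {..<N}) \<partial>M)"
  proof (rule expectation_Max_ge)
    show "finite {..<N}" "{..<N} \<noteq> {}" "exp 4 \<le> real (card {..<N})" using N N0 by auto
    show "0 < unit_var" by (rule unit_var_pos)
    show "centered_normal M (u (P j)) unit_var" for j
      using solution_centered_normal[OF u, of "P j"] by (simp add: var) (simp add: P_def)
    show "centered_normal M (\<lambda>\<omega>. u (P i) \<omega> + u (P j) \<omega>) (2 * unit_var + 2 * u_cov \<alpha> H (P i) (P j))" for i j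
      using solution_centered_normal_pair(2)[OF u, of "P i" "P j"] by (simp add: var) (simp add: P_def)
    show "u_cov \<alpha> H (P i) (P i) = unit_var" for i by (rule var)
    fix i j :: nat assume "i \<noteq> j"
    then have "1 \<le> \<bar>real i - real j\<bar>" by linarith
    then have "1 * (L / real N) \<le> \<bar>real i - real j\<bar> * (L / real N)"
      using L N0 by (intro mult_right_mono) auto
    also have "\<dots> = \<bar>real i * L / real N - real j * L / real N\<bar>"
      using L N0 by (simp add: abs_mult flip: left_diff_distrib diff_divide_distrib)
    finally have d: "L / real N \<le> \<bar>real i * L / real N - real j * L / real N\<bar>" by simp
    have d0: "0 < L / real N" using L N0 by simp
    have "heat_int 0 2 \<bar>real i * L / real N - real j * L / real N\<bar>
        \<le> decay_const / \<bar>real i * L / real N - real j * L / real N\<bar>"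
      using heat_int_decay[of "\<bar>real i * L / real N - real j * L / real N\<bar>"] d d0 by linarith
    also have "\<dots> \<le> decay_const / (L / real N)"
      by (intro divide_left_mono mult_pos_pos) (use d d0 decay_const_nonneg in linarith)+
    finally have "u_cov \<alpha> H (P i) (P j) \<le> c1H H * (decay_const / (L / real N))"
      unfolding P_def u_cov_time_1 using c1H_pos by (intro mult_left_mono) auto
    then have "u_cov \<alpha> H (P i) (P j) * ln (card {..<N}) \<le> c1H H * (decay_const / (L / real N)) * ln (real N)"
      unfolding card_lessThan by (rule mult_right_mono) (use N0 in simp)
    also have "\<dots> \<le> c1H H * (decay_const / (L / real N)) * real N"
      using N0 c1H_pos decay_const_nonneg L ln_bound[of "real N"] by (intro mult_left_mono) auto
    also have "\<dots> = c1H H * decay_const * (real N)\<^sup>2 / L" by (simp add: power2_eq_square)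
    also have "\<dots> \<le> unit_var" using N(2) L by (simp add: divide_le_eq)
    finally show "u_cov \<alpha> H (P i) (P j) * ln (card {..<N}) \<le> unit_var" .
  qed
  then show ?thesis by (simp add: image_image)
qed

lemma Psi_unit: "1 \<le> L \<Longrightarrow> Psi \<alpha> 1 L = 1 + sqrt (log 2 L)"
  by (simp add: Psi_def max_def)

text \<open>Below a threshold \<open>Psi\<close> is bounded and two points suffice; above it a grid
  is used. The finite set lies in the slice of time 1, so the same bound serves the rectangle and
  the single time.\<close>

lemma unit_lower_bound:
  "\<exists>c>0. \<forall>M u L. stoch_frac_heat_solution (M :: 'a measure) u \<alpha> H \<longrightarrow> 1 \<le> L \<longrightarrow>
    (\<exists>F. finite F \<and> F \<noteq> {} \<and> F \<subseteq> {1} \<times> {-L..L} \<and>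
      c * Psi \<alpha> 1 L \<le> (\<integral>\<omega>. Max ((\<lambda>p. u p \<omega>) ` F) \<partial>M))"
proof -
  \<comment> \<open>Chosen so that N^2 \<le> \<theta> L implies the hypothesis of
    \<open>grid_lower_bound\<close>; the 1 keeps the denominator away from 0.\<close>
  define \<theta> where "\<theta> = unit_var / (c1H H * decay_const + 1)"
  have K: "0 < c1H H * decay_const + 1" using c1H_pos decay_const_nonneg by (simp add: add_nonneg_pos)
  have \<theta>: "0 < \<theta>" using K unit_var_pos by (simp add: \<theta>_def)
  \<comment> \<open>Three thresholds: exp 65536 gives r = sqrt(ln L) \<ge> 256, so r/128 - 1 \<ge>
    r/256; 164^2/\<theta> gives N \<ge> 82, more than exp 4; (4/\<theta>)^2 gives N^2 \<ge> sqrt L,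
    that is ln N \<ge> (ln L)/4.\<close>
  define L1 where "L1 = max (exp 65536) (max (164\<^sup>2 / \<theta>) ((4 / \<theta>)\<^sup>2))"
  have L1: "1 \<le> L1" "exp 65536 \<le> L1" "164\<^sup>2 / \<theta> \<le> L1" "(4 / \<theta>)\<^sup>2 \<le> L1"
    by (auto simp: L1_def le_max_iff_disj)
  define g where "g = sqrt (2 * c1H H * gap_const) / sqrt (2 * pi)"
  have g: "0 < g" using c1H_pos gap_const_pos by (simp add: g_def)
  \<comment> \<open>For L \<le> L1 the two-point bound g is compared with \<open>Psi\<close> at L1.
    Beyond L1, \<open>Psi\<close> is at most 4r and the grid yields sqrt unit_var times r/256,
    whence 1024.\<close>
  define c where "c = min (g / Psi \<alpha> 1 L1) (sqrt unit_var / 1024)"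
  have Psi_pos: "0 < Psi \<alpha> 1 L" for L
    unfolding Psi_def by (intro add_pos_nonneg) (simp_all add: zero_le_log_cancel_iff)
  have c_le: "c \<le> g / Psi \<alpha> 1 L1" "c \<le> sqrt unit_var / 1024"
    unfolding c_def by (rule min.cobounded1, rule min.cobounded2)
  have c: "0 < c" using g Psi_pos unit_var_pos by (simp add: c_def)
  have "\<exists>F. finite F \<and> F \<noteq> {} \<and> F \<subseteq> {1} \<times> {-L..L} \<and>
      c * Psi \<alpha> 1 L \<le> (\<integral>\<omega>. Max ((\<lambda>p. u p \<omega>) ` F) \<partial>M)"
    if u: "stoch_frac_heat_solution M u \<alpha> H" and L: "1 \<le> L" for M :: "'a measure" and u L
  proof (cases "L \<le> L1")
    case True
    have "Psi \<alpha> 1 L \<le> Psi \<alpha> 1 L1" using True L L1(1) by (simp add: Psi_unit)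
    then have "c * Psi \<alpha> 1 L \<le> (g / Psi \<alpha> 1 L1) * Psi \<alpha> 1 L1"
      using c_le(1) c g Psi_pos[of L] Psi_pos[of L1] by (intro mult_mono) auto
    also have "\<dots> = g" using Psi_pos[of L1] by simp
    also have "\<dots> \<le> (\<integral>\<omega>. Max ((\<lambda>p. u p \<omega>) ` {(1, - L), (1, L)}) \<partial>M)"
      unfolding g_def by (rule two_point_lower_bound[OF u L])
    finally show ?thesis using L by (intro exI[of _ "{(1, - L), (1, L)}"]) simp
  next
    case False
    then have LL1: "L1 \<le> L" by simp
    define N where "N = nat \<lfloor>sqrt (\<theta> * L)\<rfloor>"
    have "164\<^sup>2 \<le> \<theta> * L"
      using order_trans[OF L1(3) LL1] \<theta> by (simp add: divide_le_eq mult.commute)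
    then have s164: "164 \<le> sqrt (\<theta> * L)" by (rule real_le_rsqrt)
    have N_le: "real N \<le> sqrt (\<theta> * L)" and N_ge: "sqrt (\<theta> * L) - 1 \<le> real N"
      using s164 unfolding N_def by linarith+
    have exp4: "exp 4 \<le> (81::real)"
    proof -
      have "exp (4::real) = exp 1 ^ 4" by (simp flip: exp_of_nat_mult)
      also have "\<dots> \<le> 3 ^ 4" using exp_le by (intro power_mono) auto
      finally show ?thesis by simp
    qed
    have N_half: "sqrt (\<theta> * L) / 2 \<le> real N" using N_ge s164 by linarith
    have N4: "exp 4 \<le> real N" using exp4 N_half s164 by linarith
    have N2: "c1H H * decay_const * (real N)\<^sup>2 \<le> unit_var * L"
    proof -
      have "(real N)\<^sup>2 \<le> (sqrt (\<theta> * L))\<^sup>2" using N_le by (intro power_mono) auto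
      also have "\<dots> = \<theta> * L" using \<theta> L by simp
      finally have "c1H H * decay_const * (real N)\<^sup>2 \<le> (c1H H * decay_const + 1) * (\<theta> * L)"
        using c1H_pos decay_const_nonneg by (intro mult_mono) auto
      also have "\<dots> = unit_var * L" using K by (simp add: \<theta>_def)
      finally show ?thesis .
    qed
    have lnN: "ln L / 4 \<le> ln (real N)"
    proof -
      have "4 / \<theta> \<le> sqrt L" using order_trans[OF L1(4) LL1] by (rule real_le_rsqrt)
      then have "4 / \<theta> * sqrt L \<le> sqrt L * sqrt L" using L by (intro mult_right_mono) auto
      then have "sqrt L \<le> \<theta> * L / 4" using \<theta> L by (simp add: field_simps)
      also have "\<dots> = (sqrt (\<theta> * L) / 2)\<^sup>2" using \<theta> L by (simp add: power_divide)
      also have "\<dots> \<le> (real N)\<^sup>2" using N_half \<theta> L by (intro power_mono) auto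
      finally have "ln (sqrt L) \<le> ln ((real N)\<^sup>2)" using L by (intro ln_mono) auto
      then show ?thesis using L by (simp add: ln_sqrt ln_realpow)
    qed
    have lnL: "65536 \<le> ln L"
      using order_trans[OF L1(2) LL1] L by (simp add: ln_ge_iff)
    have log: "0 \<le> log 2 L" "log 2 L \<le> 4 * ln L" "1 \<le> log 2 L"
    proof -
      have l2: "1 / 2 \<le> ln (2::real)" "ln (2::real) \<le> 1" using ln_2_less_1 ln2_ge_two_thirds by auto
      have "ln L = log 2 L * ln 2" by (simp add: log_def)
      moreover show l: "0 \<le> log 2 L" using L by simp
      moreover have "log 2 L * (1 / 2) \<le> log 2 L * ln 2" "log 2 L * ln 2 \<le> log 2 L * 1"
        using l l2 by (intro mult_left_mono; simp)+
      ultimately show "log 2 L \<le> 4 * ln L" "1 \<le> log 2 L" using lnL by linarith+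
    qed
    define r where "r = sqrt (ln L)"
    have r: "256 \<le> r" unfolding r_def using lnL by (intro real_le_rsqrt) simp
    have "sqrt (log 2 L) \<le> sqrt (4 * ln L)" using log by simp
    then have "sqrt (log 2 L) \<le> 2 * r" by (simp add: r_def real_sqrt_mult)
    then have PsiL: "Psi \<alpha> 1 L \<le> 4 * r" using L r by (simp add: Psi_unit)
    have "sqrt (ln L / 4) \<le> sqrt (ln (real N))" using lnN by simp
    then have rN: "r / 2 \<le> sqrt (ln (real N))" by (simp add: r_def real_sqrt_divide)
    have "c * Psi \<alpha> 1 L \<le> sqrt unit_var / 1024 * (4 * r)"
      using PsiL c_le(2) Psi_pos[of L] unit_var_pos by (intro mult_mono) auto
    also have "\<dots> = sqrt unit_var * (r / 256)" by simp
    also have "\<dots> \<le> sqrt unit_var * (sqrt (ln (real N)) / 64 - 1)"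
      using rN r unit_var_pos by (intro mult_left_mono) auto
    also have "\<dots> \<le> (\<integral>\<omega>. Max ((\<lambda>p. u p \<omega>) ` ((\<lambda>i. (1, real i * L / real N)) ` {..<N})) \<partial>M)"
      using L by (intro grid_lower_bound[OF u _ N4 N2]) simp
    finally have "c * Psi \<alpha> 1 L \<le> (\<integral>\<omega>. Max ((\<lambda>p. u p \<omega>) ` ((\<lambda>i. (1, real i * L / real N)) ` {..<N})) \<partial>M)" .
    moreover have "0 < N" using N_half s164 by (auto intro: gr0I)
    moreover have "- L \<le> real i * L / real N \<and> real i * L / real N \<le> L" if "i < N" for i
    proof -
      have "real i * L \<le> real N * L" using that L by (intro mult_right_mono) auto
      then have "real i * L / real N \<le> L" using that by (simp add: divide_le_eq mult.commute)
      moreover have "0 \<le> real i * L / real N" using L by simp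
      ultimately show ?thesis using L by linarith
    qed
    ultimately show ?thesis
      by (intro exI[of _ "(\<lambda>i. (1, real i * L / real N)) ` {..<N}"]) auto
  qed
  with c show ?thesis by blast
qed

subsection \<open>Removing the normalization by scaling\<close>

lemma expectation_Max_dilate:
  assumes F: "finite F" "F \<noteq> {}" and T: "0 < T"
  shows "(\<integral>\<omega>. Max ((\<lambda>p. u p \<omega>) ` (dilate T ` F)) \<partial>M)
    = T powr \<gamma> * (\<integral>\<omega>. Max ((\<lambda>p. T powr (- \<gamma>) * u (dilate T p) \<omega>) ` F) \<partial>M)"
proof -
  have pos: "0 < T powr (- \<gamma>)" using T by simp
  have "mono (\<lambda>x. T powr (- \<gamma>) * x)" by (intro monoI mult_left_mono) auto
  then have "Max ((\<lambda>p. T powr (- \<gamma>) * u (dilate T p) \<omega>) ` F) = T powr (- \<gamma>) * Max ((\<lambda>p. u p \<omega>) ` (dilate T ` F))" for \<omega>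
    using F by (subst mono_Max_commute) (auto simp: image_image)
  moreover have "T powr \<gamma> * T powr (- \<gamma>) = 1" using T by (simp flip: powr_add)
  ultimately show ?thesis by (simp flip: mult.assoc)
qed

lemma dilate_subset:
  assumes T: "0 < T" and F: "F \<subseteq> I \<times> {-(L / T powr (1 / \<alpha>))..L / T powr (1 / \<alpha>)}"
  shows "dilate T ` F \<subseteq> (\<lambda>t. T * t) ` I \<times> {-L..L}"
proof -
  have k: "0 < T powr (1 / \<alpha>)" using T by simp
  have "T powr (1 / \<alpha>) * x \<le> L \<and> - L \<le> T powr (1 / \<alpha>) * x"
    if "- (L / T powr (1 / \<alpha>)) \<le> x" "x \<le> L / T powr (1 / \<alpha>)" for x
    using that k by (simp add: field_simps)
  then show ?thesis using F by (force simp: dilate_def)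
qed

lemma Psi_scale: "Psi \<alpha> T L = Psi \<alpha> 1 (L / T powr (1 / \<alpha>))"
  by (simp add: Psi_def)

text \<open>Every finite subset is pulled back to unit time, where the bound depends only on
  L/T^(1/\<alpha>).\<close>

lemma exp_sup_upper:
  assumes u: "stoch_frac_heat_solution M u \<alpha> H" and T: "0 < T" and L: "0 < L"
  shows "exp_sup M u ({0..T} \<times> {-L..L}) \<le> ereal (2 * chain_const * T powr \<gamma> * Psi \<alpha> T L)"
  unfolding exp_sup_def
proof (rule SUP_least)
  fix F assume "F \<in> {F. finite F \<and> F \<noteq> {} \<and> F \<subseteq> {0..T} \<times> {-L..L}}"
  then have F: "finite F" "F \<noteq> {}" "F \<subseteq> {0..T} \<times> {-L..L}" by auto
  define k where "k = T powr (1 / \<alpha>)"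
  have k: "0 < k" using T by (simp add: k_def)
  define F' where "F' = (\<lambda>p. (fst p / T, snd p / k)) ` F"
  have F_eq: "F = dilate T ` F'"
    using T k by (simp add: F'_def image_image dilate_def k_def[symmetric])
  have F': "finite F'" "F' \<noteq> {}" using F by (simp_all add: F'_def)
  have "F' \<subseteq> {0..1} \<times> {-(L / k)..L / k}"
  proof
    fix y assume "y \<in> F'"
    then obtain p where p: "p \<in> F" "y = (fst p / T, snd p / k)" by (auto simp: F'_def)
    then have "0 \<le> fst p" "fst p \<le> T" "- L \<le> snd p" "snd p \<le> L" using F(3) by auto
    then show "y \<in> {0..1} \<times> {-(L / k)..L / k}"
      using T k divide_right_mono[of "- L" "snd p" k] by (simp add: p(2) divide_right_mono)
  qed
  then have "(\<integral>\<omega>. Max ((\<lambda>p. T powr (- \<gamma>) * u (dilate T p) \<omega>) ` F') \<partial>M) \<le> 2 * chain_const * Psi \<alpha> 1 (L / k)"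
    using L k F' by (intro unit_upper_bound[OF solution_dilate[OF u T]]) auto
  then have "T powr \<gamma> * (\<integral>\<omega>. Max ((\<lambda>p. T powr (- \<gamma>) * u (dilate T p) \<omega>) ` F') \<partial>M)
      \<le> T powr \<gamma> * (2 * chain_const * Psi \<alpha> 1 (L / k))"
    by (rule mult_left_mono) simp
  then show "ereal (\<integral>\<omega>. Max ((\<lambda>p. u p \<omega>) ` F) \<partial>M) \<le> ereal (2 * chain_const * T powr \<gamma> * Psi \<alpha> T L)"
    unfolding F_eq expectation_Max_dilate[OF F' T] Psi_scale[of T L] k_def[symmetric]
    by (simp add: mult_ac)
qed

lemma exp_sup_lowerI:
  assumes T: "0 < T" and F: "finite F" "F \<noteq> {}" "dilate T ` F \<subseteq> S"
    and c: "c \<le> (\<integral>\<omega>. Max ((\<lambda>p. T powr (- \<gamma>) * u (dilate T p) \<omega>) ` F) \<partial>M)"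
  shows "ereal (T powr \<gamma> * c) \<le> exp_sup M u S"
proof -
  have "ereal (T powr \<gamma> * c) \<le> ereal (\<integral>\<omega>. Max ((\<lambda>p. u p \<omega>) ` (dilate T ` F)) \<partial>M)"
    unfolding expectation_Max_dilate[OF F(1,2) T] using c by (simp add: mult_left_mono)
  also have "\<dots> \<le> exp_sup M u S"
    unfolding exp_sup_def using F by (intro SUP_upper) simp
  finally show ?thesis .
qed

lemma exp_sup_mono: "S \<subseteq> S' \<Longrightarrow> exp_sup M u S \<le> exp_sup M u S'"
  unfolding exp_sup_def by (rule SUP_subset_mono) auto

lemma exp_sup_lower_large:
  "\<exists>c>0. \<forall>M u T L. stoch_frac_heat_solution (M :: 'a measure) u \<alpha> H \<longrightarrow> 0 < T \<longrightarrow> T powr (1 / \<alpha>) \<le> L \<longrightarrow>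
    ereal (c * T powr \<gamma> * Psi \<alpha> T L) \<le> exp_sup M u ({T} \<times> {-L..L})"
proof -
  obtain c where c: "0 < c" and lower: "\<And>(M :: 'a measure) u L. stoch_frac_heat_solution M u \<alpha> H \<Longrightarrow> 1 \<le> L \<Longrightarrow>
    (\<exists>F. finite F \<and> F \<noteq> {} \<and> F \<subseteq> {1} \<times> {-L..L} \<and>
      c * Psi \<alpha> 1 L \<le> (\<integral>\<omega>. Max ((\<lambda>p. u p \<omega>) ` F) \<partial>M))"
    using unit_lower_bound[where ?'a = 'a] by metis
  have "ereal (c * T powr \<gamma> * Psi \<alpha> T L) \<le> exp_sup M u ({T} \<times> {-L..L})"
    if u: "stoch_frac_heat_solution M u \<alpha> H" and T: "0 < T" and L: "T powr (1 / \<alpha>) \<le> L"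
    for M :: "'a measure" and u T L
  proof -
    define k where "k = T powr (1 / \<alpha>)"
    have "0 < k" "k \<le> L" using T L by (simp_all add: k_def)
    then have "1 \<le> L / k" by simp
    then obtain F where F: "finite F" "F \<noteq> {}" "F \<subseteq> {1} \<times> {-(L / k)..L / k}"
      and m: "c * Psi \<alpha> 1 (L / k) \<le> (\<integral>\<omega>. Max ((\<lambda>p. T powr (- \<gamma>) * u (dilate T p) \<omega>) ` F) \<partial>M)"
      using lower[OF solution_dilate[OF u T]] by blast
    have "ereal (T powr \<gamma> * (c * Psi \<alpha> 1 (L / k))) \<le> exp_sup M u ({T} \<times> {-L..L})"
      using dilate_subset[OF T F(3)[unfolded k_def]] by (intro exp_sup_lowerI[OF T F(1,2) _ m]) simp
    then show ?thesis unfolding Psi_scale[of T L] k_def[symmetric] by (simp add: mult_ac)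
  qed
  with c show ?thesis by blast
qed

text \<open>In this regime \<open>Psi\<close> equals 1, so a multiple of T^\<gamma> suffices, and x
  = 0 at times T and 0 provides it.\<close>

lemma exp_sup_lower_small:
  assumes u: "stoch_frac_heat_solution M u \<alpha> H" and T: "0 < T" and L: "0 < L" "L \<le> T powr (1 / \<alpha>)"
  shows "ereal (sqrt unit_var / sqrt (2 * pi) * T powr \<gamma> * Psi \<alpha> T L) \<le> exp_sup M u ({0..T} \<times> {-L..L})"
proof -
  have "dilate T ` {(1, 0), (0, 0)} \<subseteq> {0..T} \<times> {-L..L}"
    using T L by (simp add: dilate_def)
  then have "ereal (T powr \<gamma> * (sqrt unit_var / sqrt (2 * pi))) \<le> exp_sup M u ({0..T} \<times> {-L..L})"
    using expectation_Max_origin[OF solution_dilate[OF u T]]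
    by (intro exp_sup_lowerI[OF T, of "{(1, 0), (0, 0)}"]) auto
  moreover have "Psi \<alpha> T L = 1" using L T by (simp add: Psi_def max_def divide_le_eq)
  ultimately show ?thesis by (simp add: mult_ac)
qed

end

theorem theorem1p1:
  fixes \<alpha> H :: real
  assumes "1 < \<alpha>" and "\<alpha> < 2" and "(2 - \<alpha>) / 2 < H" and "H < 1 / 2"
  shows
   "(\<exists>c11 c12. 0 < c11 \<and> 0 < c12 \<and>
      (\<forall>(M::'a measure) u. stoch_frac_heat_solution M u \<alpha> H \<longrightarrow>
        (\<forall>T L. 0 < T \<longrightarrow> 0 < L \<longrightarrow>
           ereal (c11 * T powr ((2 * H + \<alpha> - 2) / (2 * \<alpha>)) * Psi \<alpha> T L)
             \<le> exp_sup M u ({0..T} \<times> {-L..L}) \<and>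
           exp_sup M u ({0..T} \<times> {-L..L})
             \<le> ereal (c12 * T powr ((2 * H + \<alpha> - 2) / (2 * \<alpha>)) * Psi \<alpha> T L))))
    \<and>
    (\<exists>c13 c14. 0 < c13 \<and> 0 < c14 \<and>
      (\<forall>(M::'a measure) u. stoch_frac_heat_solution M u \<alpha> H \<longrightarrow>
        (\<forall>t L. 0 < t \<longrightarrow> t powr (1 / \<alpha>) \<le> L \<longrightarrow>
           ereal (c13 * t powr ((2 * H + \<alpha> - 2) / (2 * \<alpha>)) * Psi \<alpha> t L)
             \<le> exp_sup M u ({t} \<times> {-L..L}) \<and>
           exp_sup M u ({t} \<times> {-L..L})
             \<le> ereal (c14 * t powr ((2 * H + \<alpha> - 2) / (2 * \<alpha>)) * Psi \<alpha> t L))))"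
proof -
  interpret heat_parameters \<alpha> H by standard (fact assms)+
  obtain c where c: "0 < c" and large: "\<And>(M :: 'a measure) u T L. stoch_frac_heat_solution M u \<alpha> H \<Longrightarrow> 0 < T \<Longrightarrow>
      T powr (1 / \<alpha>) \<le> L \<Longrightarrow> ereal (c * T powr \<gamma> * Psi \<alpha> T L) \<le> exp_sup M u ({T} \<times> {-L..L})"
    using exp_sup_lower_large[where ?'a = 'a] by metis
  \<comment> \<open>The lower bound of (a) has two regimes, L above and below T^(1/\<alpha>), each
    with its own constant.\<close>
  define c' where "c' = min c (sqrt unit_var / sqrt (2 * pi))"
  have c': "0 < c'" using c unit_var_pos by (simp add: c'_def)
  have C: "0 < 2 * chain_const"
  proof -
    have "0 \<le> (\<Sum>k. ratio ^ k * (2 * real k + 4))"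
      using ratio by (intro suminf_nonneg summable_chain) auto
    then show ?thesis unfolding chain_const_def using mod_const_pos by simp
  qed
  have Psi_nonneg: "0 \<le> Psi \<alpha> T L" for T L
    unfolding Psi_def by (intro add_nonneg_nonneg) (simp_all add: zero_le_log_cancel_iff)
  have both: "ereal (c' * T powr \<gamma> * Psi \<alpha> T L) \<le> exp_sup M u ({0..T} \<times> {-L..L})"
    if u: "stoch_frac_heat_solution M u \<alpha> H" and T: "0 < T" and L: "0 < L" for M :: "'a measure" and u T L
  proof (cases "T powr (1 / \<alpha>) \<le> L")
    case True
    have "ereal (c' * T powr \<gamma> * Psi \<alpha> T L) \<le> ereal (c * T powr \<gamma> * Psi \<alpha> T L)"
      using Psi_nonneg by (simp add: c'_def mult_right_mono)
    also have "\<dots> \<le> exp_sup M u ({T} \<times> {-L..L})" by (rule large[OF u T True])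
    also have "\<dots> \<le> exp_sup M u ({0..T} \<times> {-L..L})" using T by (intro exp_sup_mono) auto
    finally show ?thesis .
  next
    case False
    have "ereal (c' * T powr \<gamma> * Psi \<alpha> T L) \<le> ereal (sqrt unit_var / sqrt (2 * pi) * T powr \<gamma> * Psi \<alpha> T L)"
      using Psi_nonneg by (simp only: ereal_less_eq) (intro mult_right_mono, simp_all add: c'_def)
    also have "\<dots> \<le> exp_sup M u ({0..T} \<times> {-L..L})"
      using False by (intro exp_sup_lower_small[OF u T L]) simp
    finally show ?thesis .
  qed
  \<comment> \<open>A time slice lies in the rectangle, so the upper constant of (a) also serves in
    (b).\<close>
  have upper: "exp_sup M u ({t} \<times> {-L..L}) \<le> ereal (2 * chain_const * t powr \<gamma> * Psi \<alpha> t L)"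
    if u: "stoch_frac_heat_solution M u \<alpha> H" and t: "0 < t" and L: "t powr (1 / \<alpha>) \<le> L" for M :: "'a measure" and u t L
  proof -
    have "0 < t powr (1 / \<alpha>)" using t by simp
    then have "0 < L" using L by linarith
    have "exp_sup M u ({t} \<times> {-L..L}) \<le> exp_sup M u ({0..t} \<times> {-L..L})"
      using t by (intro exp_sup_mono) auto
    also have "\<dots> \<le> ereal (2 * chain_const * t powr \<gamma> * Psi \<alpha> t L)"
      by (rule exp_sup_upper[OF u t \<open>0 < L\<close>])
    finally show ?thesis .
  qed
  show ?thesis
    unfolding \<gamma>_eq
  proof (intro conjI)
    show "\<exists>c11 c12. 0 < c11 \<and> 0 < c12 \<and>
      (\<forall>(M::'a measure) u. stoch_frac_heat_solution M u \<alpha> H \<longrightarrow>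
        (\<forall>T L. 0 < T \<longrightarrow> 0 < L \<longrightarrow>
           ereal (c11 * T powr \<gamma> * Psi \<alpha> T L) \<le> exp_sup M u ({0..T} \<times> {-L..L}) \<and>
           exp_sup M u ({0..T} \<times> {-L..L}) \<le> ereal (c12 * T powr \<gamma> * Psi \<alpha> T L)))"
      by (intro exI[of _ c'] exI[of _ "2 * chain_const"] conjI allI impI c' C both exp_sup_upper)
    show "\<exists>c13 c14. 0 < c13 \<and> 0 < c14 \<and>
      (\<forall>(M::'a measure) u. stoch_frac_heat_solution M u \<alpha> H \<longrightarrow>
        (\<forall>t L. 0 < t \<longrightarrow> t powr (1 / \<alpha>) \<le> L \<longrightarrow>
           ereal (c13 * t powr \<gamma> * Psi \<alpha> t L) \<le> exp_sup M u ({t} \<times> {-L..L}) \<and>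
           exp_sup M u ({t} \<times> {-L..L}) \<le> ereal (c14 * t powr \<gamma> * Psi \<alpha> t L)))"
      by (intro exI[of _ c] exI[of _ "2 * chain_const"] conjI allI impI c C large upper)
  qed
qed

end
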